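(* Let $k$ be a natural number and let $c \geq 7$ be an integer. Then there are infinitely many (pairwise non-isomorphic) connected cactus graphs $G$ that have exactly $k$ cycles of length $c$ and that contain exactly $2k$ good vertices.
   Context: All graphs are finite, simple, undirected. A cactus is a connected graph in which every edge belongs to at most one cycle. For a connected graph $G$, the Wiener index is $W(G)=\sum_{\{u,v\}\subseteq V(G)} \mathrm{dist}_G(u,v)$, the sum over unordered pairs of distinct vertices; the Wiener index of a disconnected graph is defined to be $\infty$. A vertex $v$ of a connected graph $G$ is good if $W(G)=W(G-v)$, where $G-v$ is obtained by deleting $v$ and its incident edges. *)

theory Defs
  imports Main "HOL-Library.Extended_Nat"
begin

definition simple_graph :: "'a set \<Rightarrow> 'a set set \<Rightarrow> bool" where
  "simple_graph V E \<longleftrightarrow> finite V \<and>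
     (\<forall>e\<in>E. \<exists>u v. u \<in> V \<and> v \<in> V \<and> u \<noteq> v \<and> e = {u, v})"

definition is_walk :: "'a set \<Rightarrow> 'a set set \<Rightarrow> 'a list \<Rightarrow> bool" where
  "is_walk V E xs \<longleftrightarrow> xs \<noteq> [] \<and> set xs \<subseteq> V \<and>
     (\<forall>i. Suc i < length xs \<longrightarrow> {xs ! i, xs ! Suc i} \<in> E)"

definition connected_graph :: "'a set \<Rightarrow> 'a set set \<Rightarrow> bool" where
  "connected_graph V E \<longleftrightarrow>
     (\<forall>u\<in>V. \<forall>v\<in>V. \<exists>xs. is_walk V E xs \<and> hd xs = u \<and> last xs = v)"

definition gdist :: "'a set \<Rightarrow> 'a set set \<Rightarrow> 'a \<Rightarrow> 'a \<Rightarrow> nat" where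
  "gdist V E u v = (LEAST n. \<exists>xs. is_walk V E xs \<and> hd xs = u \<and> last xs = v
                                  \<and> length xs = Suc n)"

text \<open>Wiener index: sum of distances over unordered pairs of distinct vertices
(= half the sum over ordered pairs); infinite for disconnected graphs.\<close>
definition wiener :: "'a set \<Rightarrow> 'a set set \<Rightarrow> enat" where
  "wiener V E = (if connected_graph V E
                 then enat ((\<Sum>u\<in>V. \<Sum>v\<in>V. gdist V E u v) div 2)
                 else \<infinity>)"

definition del_vertex_E :: "'a set set \<Rightarrow> 'a \<Rightarrow> 'a set set" where
  "del_vertex_E E v = {e \<in> E. v \<notin> e}"

definition good_vertex :: "'a set \<Rightarrow> 'a set set \<Rightarrow> 'a \<Rightarrow> bool" where
  "good_vertex V E v \<longleftrightarrow> v \<in> V \<and> wiener V E = wiener (V - {v}) (del_vertex_E E v)"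

definition is_cycle :: "'a set \<Rightarrow> 'a set set \<Rightarrow> 'a set set \<Rightarrow> bool" where
  "is_cycle V E C \<longleftrightarrow> (\<exists>xs. length xs \<ge> 3 \<and> distinct xs \<and> set xs \<subseteq> V \<and>
      C = {{xs ! i, xs ! ((i + 1) mod length xs)} | i. i < length xs} \<and> C \<subseteq> E)"

definition cactus :: "'a set \<Rightarrow> 'a set set \<Rightarrow> bool" where
  "cactus V E \<longleftrightarrow> simple_graph V E \<and> connected_graph V E \<and>
     (\<forall>e\<in>E. \<forall>C1 C2. is_cycle V E C1 \<and> is_cycle V E C2 \<and> e \<in> C1 \<and> e \<in> C2 \<longrightarrow> C1 = C2)"

definition graph_iso :: "'a set \<times> 'a set set \<Rightarrow> 'b set \<times> 'b set set \<Rightarrow> bool" where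
  "graph_iso G H \<longleftrightarrow> (\<exists>f. bij_betw f (fst G) (fst H) \<and>
     (\<forall>u\<in>fst G. \<forall>v\<in>fst G. {u, v} \<in> snd G \<longleftrightarrow> {f u, f v} \<in> snd H))"

end

theory Submission
  imports Defs
begin

text \<open>
  Glue \<open>k\<close> copies of the cycle \<open>C\<^sub>c\<close> and a tree at a common vertex \<open>0\<close>. Vertices of the
  tree are pendant or cut vertices, hence never good. Let \<open>R\<close> be the sum of the distances to \<open>0\<close>
  within \<open>C\<^sub>c\<close>, and let \<open>n + 1\<close> and \<open>D\<close> be the order and the sum of the distances to \<open>0\<close> of the
  graph without the cycle's other vertices. Deleting the vertex at position \<open>t\<close> turns the cycle into
  a path on \<open>c - 1\<close> vertices, and with \<open>P t\<close> the sum of the distances to \<open>0\<close> in it, that vertex is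
  good iff \<open>W(C\<^sub>c) + n R + D = W(path) + n P t\<close>. As \<open>P\<close> is strictly convex and symmetric, if \<open>t = 1\<close>
  is a solution then the only other one is \<open>t = c - 1\<close>. Put \<open>F = P 1 - R\<close>, which is at least 2 for
  \<open>c \<ge> 7\<close>. A new leaf at depth \<open>F - 1\<close>, \<open>F\<close> or \<open>F + 1\<close> of the tree changes \<open>D - F n\<close> by \<open>-1\<close>,
  \<open>0\<close> or \<open>1\<close>, so the equation for \<open>t = 1\<close> can be met by arbitrarily large trees.
\<close>

section \<open>Distances\<close>

text \<open>Edges as a relation: walks of length \<open>n\<close> become the power
  \<open>^^ n\<close>, and connectivity becomes the reflexive transitive closure.\<close>

definition adj :: "'a set set \<Rightarrow> ('a \<times> 'a) set" where
  "adj E = {(x, y). {x, y} \<in> E}"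

lemma adj_iff [simp]: "(x, y) \<in> adj E \<longleftrightarrow> {x, y} \<in> E"
  by (simp add: adj_def)

lemma sym_adj: "sym (adj E)"
  by (auto simp: sym_def insert_commute)

definition cgraph :: "'a set \<Rightarrow> 'a set set \<Rightarrow> bool" where
  "cgraph V E \<longleftrightarrow> simple_graph V E \<and> connected_graph V E"

lemma simple_graphD:
  assumes "simple_graph V E" "{x, y} \<in> E"
  shows "x \<in> V" "y \<in> V" "x \<noteq> y"
  using assms unfolding simple_graph_def by (fastforce simp: doubleton_eq_iff)+

lemma simple_graph_edgeE:
  assumes "simple_graph V E" "e \<in> E"
  obtains x y where "x \<in> V" "y \<in> V" "x \<noteq> y" "e = {x, y}"
  using assms unfolding simple_graph_def by blast

text \<open>The assumption on \<open>u\<close> settles \<open>n = 0\<close>: the zeroth power is the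
  identity on the whole type, while a walk has to stay in \<open>V\<close>. All later vertices are
  ends of edges.\<close>

lemma walk_iff_relpow:
  assumes "simple_graph V E" "u \<in> V"
  shows "(\<exists>xs. is_walk V E xs \<and> hd xs = u \<and> last xs = v \<and> length xs = Suc n)
    \<longleftrightarrow> (u, v) \<in> adj E ^^ n"
proof
  assume "\<exists>xs. is_walk V E xs \<and> hd xs = u \<and> last xs = v \<and> length xs = Suc n"
  then obtain xs where xs: "is_walk V E xs" "hd xs = u" "last xs = v" "length xs = Suc n"
    by blast
  then have "xs ! 0 = u" "xs ! n = v"
    by (auto simp: is_walk_def hd_conv_nth last_conv_nth)
  moreover have "\<forall>i<n. (xs ! i, xs ! Suc i) \<in> adj E"
    using xs by (auto simp: is_walk_def)
  ultimately show "(u, v) \<in> adj E ^^ n"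
    unfolding relpow_fun_conv by blast
next
  assume "(u, v) \<in> adj E ^^ n"
  then obtain f where f: "f 0 = u" "f n = v" "\<And>i. i < n \<Longrightarrow> {f i, f (Suc i)} \<in> E"
    unfolding relpow_fun_conv by auto
  have "f i \<in> V" if "i \<le> n" for i
  proof (cases i)
    case 0
    then show ?thesis using f(1) assms(2) by simp
  next
    case (Suc j)
    then show ?thesis using simple_graphD(2)[OF assms(1) f(3)[of j]] that by simp
  qed
  then have "is_walk V E (map f [0..<Suc n])"
    using f(3) by (auto simp: is_walk_def simp del: upt_Suc)
  moreover have "hd (map f [0..<Suc n]) = u" "last (map f [0..<Suc n]) = v"
    using f(1,2) by (auto simp: hd_conv_nth last_conv_nth simp del: upt_Suc)
  ultimately show "\<exists>xs. is_walk V E xs \<and> hd xs = u \<and> last xs = v \<and> length xs = Suc n"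
    by (intro exI[of _ "map f [0..<Suc n]"]) simp
qed

lemma gdist_relpow:
  assumes "simple_graph V E" "u \<in> V"
  shows "gdist V E u v = (LEAST n. (u, v) \<in> adj E ^^ n)"
  unfolding gdist_def walk_iff_relpow[OF assms] ..

lemma connected_graph_iff:
  assumes "simple_graph V E"
  shows "connected_graph V E \<longleftrightarrow> (\<forall>u\<in>V. \<forall>v\<in>V. (u, v) \<in> (adj E)\<^sup>*)"
proof -
  have "(\<exists>xs. is_walk V E xs \<and> hd xs = u \<and> last xs = v) \<longleftrightarrow> (u, v) \<in> (adj E)\<^sup>*"
    if "u \<in> V" for u v
  proof -
    have "(\<exists>xs. is_walk V E xs \<and> hd xs = u \<and> last xs = v) \<longleftrightarrow>
      (\<exists>n xs. is_walk V E xs \<and> hd xs = u \<and> last xs = v \<and> length xs = Suc n)"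
      by (metis is_walk_def length_0_conv not0_implies_Suc)
    then show ?thesis
      using walk_iff_relpow[OF assms that] by (auto simp: rtrancl_power)
  qed
  then show ?thesis by (simp add: connected_graph_def)
qed

lemma cgraph_finite: "cgraph V E \<Longrightarrow> finite V"
  by (simp add: cgraph_def simple_graph_def)

lemma cgraph_rtrancl:
  assumes "cgraph V E" "u \<in> V" "v \<in> V"
  shows "(u, v) \<in> (adj E)\<^sup>*"
  using assms connected_graph_iff unfolding cgraph_def by blast

lemma cgraph_reach:
  assumes "cgraph V E" "u \<in> V" "v \<in> V"
  shows "(u, v) \<in> adj E ^^ gdist V E u v"
proof -
  obtain n where "(u, v) \<in> adj E ^^ n" using cgraph_rtrancl[OF assms] by (auto simp: rtrancl_power)
  then show ?thesis
    using assms gdist_relpow unfolding cgraph_def by (metis (mono_tags) LeastI)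
qed

lemma gdist_le:
  assumes "cgraph V E" "u \<in> V" "(u, v) \<in> adj E ^^ n"
  shows "gdist V E u v \<le> n"
  using assms gdist_relpow unfolding cgraph_def by (metis Least_le)

lemma gdist_self [simp]:
  assumes "cgraph V E" "u \<in> V"
  shows "gdist V E u u = 0"
  using gdist_le[OF assms, of u 0] by simp

lemma gdist_eq_0_iff:
  assumes "cgraph V E" "u \<in> V" "v \<in> V"
  shows "gdist V E u v = 0 \<longleftrightarrow> u = v"
  using cgraph_reach[OF assms] gdist_self[OF assms(1,2)] by auto

lemma gdist_step:
  assumes "cgraph V E" "u \<in> V" "{x, y} \<in> E"
  shows "gdist V E u y \<le> Suc (gdist V E u x)"
proof -
  have "x \<in> V" using assms simple_graphD unfolding cgraph_def by metis
  then have "(u, y) \<in> adj E ^^ Suc (gdist V E u x)"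
    using cgraph_reach[OF assms(1,2)] assms(3) by (intro relpow_Suc_I) auto
  then show ?thesis by (rule gdist_le[OF assms(1,2)])
qed

lemma gdist_pred:
  assumes "cgraph V E" "u \<in> V" "v \<in> V" "u \<noteq> v"
  obtains x where "{x, v} \<in> E" "gdist V E u v = Suc (gdist V E u x)"
proof -
  obtain m where m: "gdist V E u v = Suc m"
    using gdist_eq_0_iff[OF assms(1-3)] assms(4) not0_implies_Suc by blast
  then have "(u, v) \<in> adj E ^^ Suc m"
    using cgraph_reach[OF assms(1-3)] by metis
  then obtain x where x: "(u, x) \<in> adj E ^^ m" "{x, v} \<in> E" by auto
  have "gdist V E u x = m"
    using gdist_le[OF assms(1,2) x(1)] gdist_step[OF assms(1,2) x(2)] m by simp
  then show ?thesis using that x(2) m by metis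
qed

lemma gdist_sym:
  assumes "cgraph V E" "u \<in> V" "v \<in> V"
  shows "gdist V E u v = gdist V E v u"
proof -
  have rev: "(y, x) \<in> adj E ^^ n" if "(x, y) \<in> adj E ^^ n" for x y n
    using that
  proof (induction n arbitrary: y)
    case (Suc n)
    then obtain z where z: "(x, z) \<in> adj E ^^ n" "{y, z} \<in> E"
      by (auto simp: insert_commute)
    have "(y, z) \<in> adj E" using z(2) by simp
    then show ?case using Suc.IH[OF z(1)] by (rule relpow_Suc_I2)
  qed auto
  show ?thesis
    using gdist_le[OF assms(1,2) rev[OF cgraph_reach[OF assms(1,3,2)]]]
      gdist_le[OF assms(1,3) rev[OF cgraph_reach[OF assms(1-3)]]] by (rule antisym)
qed

text \<open>Passing to the neighbours given by \<open>pred\<close> lowers \<open>d\<close> by one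
  each time, and this can only stop at \<open>u\<close>.\<close>

lemma potential_reach:
  fixes d :: "'a \<Rightarrow> nat"
  assumes sg: "simple_graph V E" and u: "u \<in> V" "d u = 0"
    and pred: "\<And>v. v \<in> V \<Longrightarrow> v \<noteq> u \<Longrightarrow> \<exists>x. {x, v} \<in> E \<and> d v = Suc (d x)"
    and v: "v \<in> V"
  shows "(u, v) \<in> adj E ^^ d v"
  using v
proof (induction "d v" arbitrary: v)
  case 0
  then show ?case using pred[of v] u by (cases "v = u") auto
next
  case (Suc n)
  then have "v \<noteq> u" using u by auto
  then obtain x where x: "{x, v} \<in> E" "d v = Suc (d x)" using pred Suc.prems by blast
  then have "(u, x) \<in> adj E ^^ d x"
    using Suc simple_graphD[OF sg x(1)] by simp
  then show ?case using x by auto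
qed

text \<open>\<open>pred\<close> bounds the distance from above; \<open>lip\<close> bounds it from
  below, as \<open>d\<close> grows by at most one along an edge. Distances in glued graphs, paths
  and cycles are found by guessing \<open>d\<close>.\<close>

lemma gdist_eqI:
  fixes d :: "'a \<Rightarrow> nat"
  assumes sg: "simple_graph V E" and u: "u \<in> V" "d u = 0"
    and pred: "\<And>v. v \<in> V \<Longrightarrow> v \<noteq> u \<Longrightarrow> \<exists>x. {x, v} \<in> E \<and> d v = Suc (d x)"
    and lip: "\<And>x y. {x, y} \<in> E \<Longrightarrow> d y \<le> Suc (d x)"
    and v: "v \<in> V"
  shows "gdist V E u v = d v"
proof -
  have low: "d w \<le> n" if "(u, w) \<in> adj E ^^ n" for w n
    using that
  proof (induction n arbitrary: w)
    case (Suc n)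
    then obtain x where "(u, x) \<in> adj E ^^ n" "{x, w} \<in> E" by auto
    then show ?case using Suc.IH[of x] lip[of x w] by simp
  qed (use u in auto)
  show ?thesis
    unfolding gdist_relpow[OF sg u(1)]
    using potential_reach[OF assms(1-4) v] low by (intro Least_equality)
qed

section \<open>Transmissions, the doubled Wiener index and good vertices\<close>

definition trans_from :: "'a set \<Rightarrow> 'a set set \<Rightarrow> 'a \<Rightarrow> nat" where
  "trans_from V E a = (\<Sum>v\<in>V. gdist V E a v)"

text \<open>Ordered pairs are counted, so for connected graphs this is twice the Wiener index and no
  halving enters the gluing formulas.\<close>

definition wiener2 :: "'a set \<Rightarrow> 'a set set \<Rightarrow> nat" where
  "wiener2 V E = (\<Sum>u\<in>V. trans_from V E u)"

text \<open>A new element adds a row and an equal column. Evenness means that the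
  \<open>div 2\<close> in \<open>wiener\<close> loses nothing.\<close>

lemma even_sym_sum:
  fixes f :: "'a \<Rightarrow> 'a \<Rightarrow> nat"
  assumes "finite V" "\<And>x. x \<in> V \<Longrightarrow> f x x = 0"
    "\<And>x y. x \<in> V \<Longrightarrow> y \<in> V \<Longrightarrow> f x y = f y x"
  shows "even (\<Sum>x\<in>V. \<Sum>y\<in>V. f x y)"
  using assms
proof (induction V)
  case (insert a V)
  have "(\<Sum>x\<in>V. f x a) = (\<Sum>y\<in>V. f a y)"
    using insert.prems by (intro sum.cong) auto
  then have "(\<Sum>x\<in>insert a V. \<Sum>y\<in>insert a V. f x y) =
      2 * (\<Sum>y\<in>V. f a y) + (\<Sum>x\<in>V. \<Sum>y\<in>V. f x y)"
    using insert.hyps insert.prems(1)[of a] by (simp add: sum.distrib)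
  then show ?case using insert by simp
qed simp

lemma even_wiener2: "cgraph V E \<Longrightarrow> even (wiener2 V E)"
  unfolding wiener2_def trans_from_def
  by (rule even_sym_sum) (auto simp: cgraph_finite intro: gdist_sym)

lemma wiener_cgraph: "cgraph V E \<Longrightarrow> wiener V E = enat (wiener2 V E div 2)"
  by (simp add: wiener_def wiener2_def trans_from_def cgraph_def)

lemma simple_graph_del:
  "simple_graph V E \<Longrightarrow> simple_graph (V - {v}) (del_vertex_E E v)"
  unfolding simple_graph_def del_vertex_E_def by fastforce

text \<open>The index of the whole graph is finite, so a disconnected remainder cannot match it;
  otherwise parity allows \<open>div 2\<close> to be cancelled on both sides.\<close>

lemma good_vertex_iff:
  assumes "cgraph V E" "v \<in> V"
  shows "good_vertex V E v \<longleftrightarrow> cgraph (V - {v}) (del_vertex_E E v) \<and>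
    wiener2 V E = wiener2 (V - {v}) (del_vertex_E E v)"
proof (cases "connected_graph (V - {v}) (del_vertex_E E v)")
  case True
  then have cg: "cgraph (V - {v}) (del_vertex_E E v)"
    using assms(1) simple_graph_del unfolding cgraph_def by metis
  show ?thesis
    using assms cg even_wiener2[OF assms(1)] even_wiener2[OF cg]
    by (auto simp: good_vertex_def wiener_cgraph elim!: evenE)
next
  case False
  then have "\<not> cgraph (V - {v}) (del_vertex_E E v)"
    by (simp add: cgraph_def)
  then show ?thesis
    using assms False by (simp add: good_vertex_def wiener_cgraph) (simp add: wiener_def)
qed

section \<open>Gluing two graphs at a vertex\<close>

text \<open>The construction proceeds by such one-vertex amalgamations: a leaf edge onto a tree, a
  petal onto a bouquet, the tree onto the bouquet.\<close>

locale glue =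
  fixes V1 :: "'a set" and E1 V2 E2 a
  assumes g1: "cgraph V1 E1" and g2: "cgraph V2 E2" and inter: "V1 \<inter> V2 = {a}"
begin

lemma a1: "a \<in> V1" and a2: "a \<in> V2"
  using inter by auto

lemma glue_swap: "glue V2 E2 V1 E1 a"
  using g1 g2 inter by unfold_locales auto

lemma sg1: "simple_graph V1 E1" and sg2: "simple_graph V2 E2"
  using g1 g2 by (auto simp: cgraph_def)

lemma simple: "simple_graph (V1 \<union> V2) (E1 \<union> E2)"
  using sg1 sg2 unfolding simple_graph_def by (metis UnE UnI1 UnI2 finite_UnI)

text \<open>The candidate for the distance from \<open>u\<close> in \<open>V1\<close>: a walk into
  \<open>V2\<close> has to pass through \<open>a\<close>.\<close>

definition pot :: "'a \<Rightarrow> 'a \<Rightarrow> nat" where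
  "pot u v = (if v \<in> V1 then gdist V1 E1 u v else gdist V1 E1 u a + gdist V2 E2 a v)"

lemma pot_V2: "u \<in> V1 \<Longrightarrow> v \<in> V2 \<Longrightarrow> pot u v = gdist V1 E1 u a + gdist V2 E2 a v"
  using inter g2 a2 by (cases "v = a") (auto simp: pot_def)

lemma pot_pred:
  assumes u: "u \<in> V1" and v: "v \<in> V1 \<union> V2" "v \<noteq> u"
  shows "\<exists>x. {x, v} \<in> E1 \<union> E2 \<and> pot u v = Suc (pot u x)"
proof (cases "v \<in> V1")
  case True
  then obtain x where "{x, v} \<in> E1" "gdist V1 E1 u v = Suc (gdist V1 E1 u x)"
    using gdist_pred[OF g1 u] v by metis
  then show ?thesis
    using True simple_graphD[OF sg1] by (intro exI[of _ x]) (auto simp: pot_def)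
next
  case False
  then have "v \<in> V2" "v \<noteq> a" using v a1 by auto
  then obtain x where "{x, v} \<in> E2" "gdist V2 E2 a v = Suc (gdist V2 E2 a x)"
    using gdist_pred[OF g2 a2] by metis
  then show ?thesis
    using \<open>v \<in> V2\<close> u simple_graphD[OF sg2] by (intro exI[of _ x]) (auto simp: pot_V2)
qed

lemma pot_lip:
  assumes u: "u \<in> V1" and e: "{x, y} \<in> E1 \<union> E2"
  shows "pot u y \<le> Suc (pot u x)"
  using e
proof
  assume "{x, y} \<in> E1"
  then show ?thesis
    using gdist_step[OF g1 u] simple_graphD[OF sg1] by (auto simp: pot_def)
next
  assume "{x, y} \<in> E2"
  then show ?thesis
    using gdist_step[OF g2 a2] simple_graphD[OF sg2] u by (auto simp: pot_V2)
qed

lemma pot_self: "u \<in> V1 \<Longrightarrow> pot u u = 0"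
  using g1 by (simp add: pot_def)

lemma gdist_glue:
  assumes "u \<in> V1" "v \<in> V1 \<union> V2"
  shows "gdist (V1 \<union> V2) (E1 \<union> E2) u v = pot u v"
  using assms pot_self pot_pred pot_lip by (intro gdist_eqI simple) auto

lemma gdist_glue11:
  "u \<in> V1 \<Longrightarrow> v \<in> V1 \<Longrightarrow> gdist (V1 \<union> V2) (E1 \<union> E2) u v = gdist V1 E1 u v"
  by (simp add: gdist_glue pot_def)

lemma gdist_glue12:
  "u \<in> V1 \<Longrightarrow> v \<in> V2 \<Longrightarrow>
    gdist (V1 \<union> V2) (E1 \<union> E2) u v = gdist V1 E1 u a + gdist V2 E2 a v"
  by (simp add: gdist_glue pot_V2)

lemma cgraph_glue: "cgraph (V1 \<union> V2) (E1 \<union> E2)"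
proof -
  have from_a: "(a, v) \<in> (adj (E1 \<union> E2))\<^sup>*" if "v \<in> V1 \<union> V2" for v
    using potential_reach[OF simple _ pot_self pot_pred that] a1
    by (auto simp: rtrancl_power)
  have "(u, v) \<in> (adj (E1 \<union> E2))\<^sup>*" if "u \<in> V1 \<union> V2" "v \<in> V1 \<union> V2" for u v
    using from_a that sym_rtrancl[OF sym_adj] by (meson rtrancl_trans symE)
  then show ?thesis
    using simple by (simp add: cgraph_def connected_graph_iff)
qed

lemma disjoint: "V1 \<inter> (V2 - {a}) = {}"
  using inter by auto

lemma sum_glue:
  fixes f :: "'a \<Rightarrow> nat"
  shows "sum f (V1 \<union> V2) = sum f V1 + sum f (V2 - {a})"
proof -
  have "V1 \<union> V2 = V1 \<union> (V2 - {a})" using a1 by auto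
  then show ?thesis
    using disjoint cgraph_finite[OF g1] cgraph_finite[OF g2]
    by (simp add: sum.union_disjoint)
qed

lemma sum_V2_dist:
  fixes t :: nat
  shows "(\<Sum>v\<in>V2 - {a}. t + gdist V2 E2 a v) = (card V2 - 1) * t + trans_from V2 E2 a"
proof -
  have "trans_from V2 E2 a = (\<Sum>v\<in>V2 - {a}. gdist V2 E2 a v)"
    unfolding trans_from_def using a2 cgraph_finite[OF g2] g2 by (simp add: sum.remove)
  then show ?thesis
    using a2 by (simp add: sum.distrib)
qed

lemma card_glue: "card (V1 \<union> V2) = card V1 + (card V2 - 1)"
  using sum_glue[of "\<lambda>_. 1"] a2 by simp

lemma trans_glue1:
  assumes "u \<in> V1"
  shows "trans_from (V1 \<union> V2) (E1 \<union> E2) u =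
    trans_from V1 E1 u + (card V2 - 1) * gdist V1 E1 u a + trans_from V2 E2 a"
proof -
  have "trans_from (V1 \<union> V2) (E1 \<union> E2) u =
      (\<Sum>v\<in>V1. gdist V1 E1 u v) + (\<Sum>v\<in>V2 - {a}. gdist V1 E1 u a + gdist V2 E2 a v)"
    unfolding trans_from_def sum_glue using assms
    by (intro arg_cong2[of _ _ _ _ "(+)"] sum.cong) (auto simp: gdist_glue11 gdist_glue12)
  then show ?thesis by (simp add: sum_V2_dist trans_from_def)
qed

lemma trans_glue: "trans_from (V1 \<union> V2) (E1 \<union> E2) a = trans_from V1 E1 a + trans_from V2 E2 a"
  using trans_glue1[OF a1] g1 a1 by simp

lemma sum_to_a: "(\<Sum>u\<in>V1. gdist V1 E1 u a) = trans_from V1 E1 a"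
  unfolding trans_from_def using gdist_sym[OF g1] a1 by (intro sum.cong) auto

lemma wiener2_split1:
  "(\<Sum>u\<in>V1. trans_from (V1 \<union> V2) (E1 \<union> E2) u) =
    wiener2 V1 E1 + (card V2 - 1) * trans_from V1 E1 a + card V1 * trans_from V2 E2 a"
  by (simp add: trans_glue1 sum.distrib wiener2_def sum_to_a flip: sum_distrib_left)

text \<open>Pairs on one side keep their distance, and the distance of a cross pair splits at
  \<open>a\<close>. Hence a distance to \<open>a\<close> is counted once for each vertex other than
  \<open>a\<close> on the opposite side, and twice because pairs are ordered.\<close>

lemma wiener2_glue:
  "wiener2 (V1 \<union> V2) (E1 \<union> E2) = wiener2 V1 E1 + wiener2 V2 E2 +
    2 * ((card V1 - 1) * trans_from V2 E2 a + (card V2 - 1) * trans_from V1 E1 a)"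
proof -
  interpret sw: glue V2 E2 V1 E1 a by (rule glue_swap)
  have ws: "(\<Sum>u\<in>V2. trans_from (V1 \<union> V2) (E1 \<union> E2) u) =
    wiener2 V2 E2 + (card V1 - 1) * trans_from V2 E2 a + card V2 * trans_from V1 E1 a"
    using sw.wiener2_split1 by (simp add: Un_commute)
  \<comment> \<open>The row of \<open>a\<close> occurs in the row sums of both sides, so it is split
    off from one of them.\<close>
  have "(\<Sum>u\<in>V2. trans_from (V1 \<union> V2) (E1 \<union> E2) u) =
      trans_from (V1 \<union> V2) (E1 \<union> E2) a + (\<Sum>u\<in>V2 - {a}. trans_from (V1 \<union> V2) (E1 \<union> E2) u)"
    using a2 cgraph_finite[OF g2] by (simp add: sum.remove)
  moreover have "wiener2 (V1 \<union> V2) (E1 \<union> E2) = (\<Sum>u\<in>V1. trans_from (V1 \<union> V2) (E1 \<union> E2) u)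
      + (\<Sum>u\<in>V2 - {a}. trans_from (V1 \<union> V2) (E1 \<union> E2) u)"
    unfolding wiener2_def sum_glue ..
  moreover obtain n1 n2 where "card V1 = Suc n1" "card V2 = Suc n2"
    using a1 a2 cgraph_finite[OF g1] cgraph_finite[OF g2]
    by (metis card_Suc_Diff1)
  ultimately show ?thesis
    using ws wiener2_split1 trans_glue by simp
qed

section \<open>Deleting a vertex of a glued graph\<close>

lemma del_glue:
  assumes "v \<in> V2" "v \<noteq> a"
  shows "V1 \<union> V2 - {v} = V1 \<union> (V2 - {v})"
    "del_vertex_E (E1 \<union> E2) v = E1 \<union> del_vertex_E E2 v"
proof -
  have "v \<notin> V1" using assms inter by auto
  then show "V1 \<union> V2 - {v} = V1 \<union> (V2 - {v})" by auto
  show "del_vertex_E (E1 \<union> E2) v = E1 \<union> del_vertex_E E2 v"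
    using \<open>v \<notin> V1\<close> simple_graph_edgeE[OF sg1] unfolding del_vertex_E_def by blast
qed

text \<open>Apply the gluing formula before and after the deletion. The index of the first side
  cancels; since the second side loses one vertex, one multiple of
  \<open>2 * trans_from V1 E1 a\<close> remains.\<close>

lemma good_glue_iff:
  assumes v: "v \<in> V2" "v \<noteq> a" and cg: "cgraph (V2 - {v}) (del_vertex_E E2 v)"
  shows "good_vertex (V1 \<union> V2) (E1 \<union> E2) v \<longleftrightarrow>
    wiener2 V2 E2 + 2 * (card V1 - 1) * trans_from V2 E2 a + 2 * trans_from V1 E1 a =
    wiener2 (V2 - {v}) (del_vertex_E E2 v) +
      2 * (card V1 - 1) * trans_from (V2 - {v}) (del_vertex_E E2 v) a"
proof -
  interpret d: glue V1 E1 "V2 - {v}" "del_vertex_E E2 v" a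
    using g1 cg inter v by unfold_locales auto
  obtain n where n: "card V2 = Suc n" "card (V2 - {v}) = n"
    using v(1) cgraph_finite[OF g2] by (metis card_Suc_Diff1)
  \<comment> \<open>The vertex \<open>a\<close> survives the deletion, so the truncated subtractions
    in both gluing formulas are exact.\<close>
  have "n > 0" using n v a2 cgraph_finite[OF g2] by (metis Diff_iff card_gt_0_iff empty_iff finite_Diff singletonD)
  then obtain m where m: "n = Suc m" using gr0_implies_Suc by blast
  show ?thesis
    using v d.cgraph_glue n m
    by (auto simp: good_vertex_iff[OF cgraph_glue] del_glue wiener2_glue d.wiener2_glue algebra_simps)
qed

text \<open>A walk starting in \<open>V2\<close> can use an edge of \<open>E1\<close> only after
  visiting \<open>a\<close>, so up to that visit it lies in the second side.\<close>

lemma connected_part: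
  assumes v: "v \<in> V2" "v \<noteq> a"
    and cg: "cgraph (V1 \<union> V2 - {v}) (del_vertex_E (E1 \<union> E2) v)"
  shows "cgraph (V2 - {v}) (del_vertex_E E2 v)"
proof -
  let ?E = "del_vertex_E E2 v"
  have sg: "simple_graph (V2 - {v}) ?E" by (rule simple_graph_del[OF sg2])
  have to_a: "(x, a) \<in> (adj ?E)\<^sup>*" if x: "x \<in> V2 - {v}" for x
  proof (rule ccontr)
    assume neg: "(x, a) \<notin> (adj ?E)\<^sup>*"
    have xa: "(x, a) \<in> (adj (E1 \<union> ?E))\<^sup>*"
      using cg x a2 v unfolding del_glue[OF v]
      by (intro cgraph_rtrancl[of "V1 \<union> (V2 - {v})"]) auto
    have "(x, y) \<in> (adj ?E)\<^sup>* \<and> y \<in> V2" if "(x, y) \<in> (adj (E1 \<union> ?E))\<^sup>*" for y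
      using that
    proof (induction rule: rtrancl_induct)
      case base
      then show ?case using x by simp
    next
      case (step y z)
      \<comment> \<open>A vertex of \<open>V2\<close> on an edge of \<open>E1\<close> must be
        \<open>a\<close>, which \<open>neg\<close> excludes.\<close>
      then have "{y, z} \<notin> E1"
        using neg simple_graphD[OF sg1] inter by (metis IntI singletonD)
      then have "{y, z} \<in> ?E" using step by simp
      moreover have "z \<in> V2" using simple_graphD[OF sg \<open>{y, z} \<in> ?E\<close>] by simp
      ultimately show ?case using step by (auto intro: rtrancl_into_rtrancl)
    qed
    then show False using neg xa by blast
  qed
  have "(x, y) \<in> (adj ?E)\<^sup>*" if "x \<in> V2 - {v}" "y \<in> V2 - {v}" for x y
    using to_a that sym_rtrancl[OF sym_adj] by (meson rtrancl_trans symE)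
  then show ?thesis using sg by (simp add: cgraph_def connected_graph_iff)
qed

text \<open>Once \<open>a\<close> is gone, no edge leads from one side to the other.\<close>

lemma cut_vertex:
  assumes "V1 \<noteq> {a}" "V2 \<noteq> {a}"
  shows "\<not> cgraph (V1 \<union> V2 - {a}) (del_vertex_E (E1 \<union> E2) a)"
proof
  assume cg: "cgraph (V1 \<union> V2 - {a}) (del_vertex_E (E1 \<union> E2) a)"
  obtain x y where xy: "x \<in> V1" "x \<noteq> a" "y \<in> V2" "y \<noteq> a"
    using assms a1 a2 by blast
  then have "(x, y) \<in> (adj (del_vertex_E (E1 \<union> E2) a))\<^sup>*"
    by (intro cgraph_rtrancl[OF cg]) auto
  then have "y \<in> V1"
  proof (induction rule: rtrancl_induct)
    case base
    then show ?case using xy by simp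
  next
    case (step y z)
    then have "y \<noteq> a" "{y, z} \<in> E1 \<union> E2" by (auto simp: del_vertex_E_def)
    then show ?case
      using step.IH simple_graphD[OF sg1] simple_graphD[OF sg2] inter by (metis IntI UnE singletonD)
  qed
  then show False using xy inter by auto
qed

end

section \<open>Cycles\<close>

definition ring_edges :: "(nat \<Rightarrow> 'a) \<Rightarrow> nat \<Rightarrow> 'a set set" where
  "ring_edges y n = {{y i, y (Suc i mod n)} | i. i < n}"

lemma ring_edgesI: "i < n \<Longrightarrow> {y i, y (Suc i mod n)} \<in> ring_edges y n"
  unfolding ring_edges_def by blast

lemma is_cycle_iff:
  "is_cycle V E C \<longleftrightarrow> (\<exists>y n. n \<ge> 3 \<and> inj_on y {..<n} \<and> y ` {..<n} \<subseteq> V \<and>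
    C = ring_edges y n \<and> C \<subseteq> E)"
proof
  assume "is_cycle V E C"
  then obtain xs where "length xs \<ge> 3" "distinct xs" "set xs \<subseteq> V"
    "C = ring_edges ((!) xs) (length xs)" "C \<subseteq> E"
    unfolding is_cycle_def ring_edges_def by auto
  moreover from this have "(!) xs ` {..<length xs} \<subseteq> V" by auto
  ultimately show "\<exists>y n. n \<ge> 3 \<and> inj_on y {..<n} \<and> y ` {..<n} \<subseteq> V \<and>
      C = ring_edges y n \<and> C \<subseteq> E"
    using inj_on_nth[of xs "{..<length xs}"] by blast
next
  assume "\<exists>y n. n \<ge> 3 \<and> inj_on y {..<n} \<and> y ` {..<n} \<subseteq> V \<and>
      C = ring_edges y n \<and> C \<subseteq> E"
  then obtain y n where y: "n \<ge> 3" "inj_on y {..<n}" "y ` {..<n} \<subseteq> V"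
    "C = ring_edges y n" "C \<subseteq> E" by blast
  let ?xs = "map y [0..<n]"
  have "{{?xs ! i, ?xs ! ((i + 1) mod length ?xs)} | i. i < length ?xs} = ring_edges y n"
    unfolding ring_edges_def using y(1)
    by (intro Collect_cong ex_cong1) auto
  then show "is_cycle V E C"
    unfolding is_cycle_def using y
    by (intro exI[of _ ?xs]) (auto simp: distinct_map atLeast0LessThan)
qed

text \<open>Together with \<open>inj_rotate\<close> this lets any vertex of a cycle take index 0 or
  the last index.\<close>

lemma ring_edges_rotate:
  assumes "n > 0"
  shows "ring_edges (\<lambda>i. y ((s + i) mod n)) n = ring_edges y n"
proof -
  have "\<exists>i'<n. {y ((s + i) mod n), y ((s + Suc i mod n) mod n)} = {y i', y (Suc i' mod n)}"
    if "i < n" for i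
    using that assms by (intro exI[of _ "(s + i) mod n"]) (simp add: mod_simps)
  moreover have "\<exists>i'<n. {y i, y (Suc i mod n)} = {y ((s + i') mod n), y ((s + Suc i' mod n) mod n)}"
    if "i < n" for i
  proof -
    \<comment> \<open>This is \<open>i - s\<close> modulo \<open>n\<close>, written so that the
      subtraction is not truncated.\<close>
    let ?i = "(i + (n - s mod n)) mod n"
    have "(s + ?i) mod n = (s mod n + (i + (n - s mod n))) mod n" by (simp add: mod_simps)
    also have "s mod n + (i + (n - s mod n)) = i + n"
      using assms mod_less_divisor[of n s] by linarith
    also have "(i + n) mod n = i" using that by simp
    finally have *: "(s + ?i) mod n = i" .
    have "(s + Suc ?i mod n) mod n = Suc ((s + ?i) mod n) mod n" by (simp add: mod_simps)
    then show ?thesis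
      using * assms by (intro exI[of _ ?i]) simp
  qed
  ultimately show ?thesis unfolding ring_edges_def by blast
qed

lemma inj_rotate:
  fixes s :: nat
  assumes "n > 0" "inj_on y {..<n}"
  shows "inj_on (\<lambda>i. y ((s + i) mod n)) {..<n}" "(\<lambda>i. y ((s + i) mod n)) ` {..<n} = y ` {..<n}"
proof -
  have "inj_on (\<lambda>i. (s + i) mod n) {..<n}"
  proof (rule inj_onI)
    fix i j assume ij: "i \<in> {..<n}" "j \<in> {..<n}" "(s + i) mod n = (s + j) mod n"
    then have "(int s + int i) mod int n = (int s + int j) mod int n"
      by (metis of_nat_add zmod_int)
    then have "int n dvd int i - int j" by (simp add: mod_eq_dvd_iff)
    then show "i = j" using ij zdvd_imp_le[of "int n" "int i - int j"]
       zdvd_imp_le[of "int n" "int j - int i"] dvd_diff_commute[of "int n" "int i" "int j"]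
      by (cases i j rule: linorder_cases) auto
  qed
  moreover have "(\<lambda>i. (s + i) mod n) ` {..<n} = {..<n}"
    using calculation assms(1) by (intro endo_inj_surj) auto
  ultimately show "inj_on (\<lambda>i. y ((s + i) mod n)) {..<n}"
    "(\<lambda>i. y ((s + i) mod n)) ` {..<n} = y ` {..<n}"
    using comp_inj_on[of "\<lambda>i. (s + i) mod n" "{..<n}" y] assms(2)
    by (simp_all add: comp_def) (metis image_image)
qed

lemma Suc_mod_inj: "i < n \<Longrightarrow> j < n \<Longrightarrow> Suc i mod n = Suc j mod n \<Longrightarrow> i = j"
  by (auto simp: mod_Suc split: if_splits)

lemma card_ring_edges:
  assumes "n \<ge> 3" "inj_on y {..<n}"
  shows "card (ring_edges y n) = n"
proof -
  have "ring_edges y n = (\<lambda>i. {y i, y (Suc i mod n)}) ` {..<n}"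
    unfolding ring_edges_def by auto
  moreover have "inj_on (\<lambda>i. {y i, y (Suc i mod n)}) {..<n}"
  proof (rule inj_onI)
    fix i j assume ij: "i \<in> {..<n}" "j \<in> {..<n}"
      and eq: "{y i, y (Suc i mod n)} = {y j, y (Suc j mod n)}"
    have "Suc i mod n < n" "Suc j mod n < n" using assms(1) by auto
    then have "i = j \<or> (i = Suc j mod n \<and> Suc i mod n = j)"
      using eq ij inj_onD[OF assms(2)] unfolding doubleton_eq_iff by (metis lessThan_iff)
    \<comment> \<open>In the second case \<open>n\<close> would divide 2, against \<open>n\<close>
      being at least 3.\<close>
    then show "i = j"
      using ij assms(1) by (auto simp: mod_Suc split: if_splits)
  qed
  ultimately show ?thesis by (simp add: card_image)
qed

lemma ring_two_edges:
  assumes "n \<ge> 3" "inj_on y {..<n}" "e \<in> ring_edges y n" "x \<in> e"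
  obtains e1 e2 where "e1 \<in> ring_edges y n" "e2 \<in> ring_edges y n" "e1 \<noteq> e2" "x \<in> e1" "x \<in> e2"
proof -
  obtain i where i: "i < n" "x = y i"
  proof -
    obtain j where j: "j < n" "e = {y j, y (Suc j mod n)}"
      using assms(3) unfolding ring_edges_def by auto
    then show ?thesis using that[of j] that[of "Suc j mod n"] assms(1,4) by auto
  qed
  \<comment> \<open>The cyclic predecessor of \<open>i\<close>; the two edges at \<open>y i\<close>
    are those with indices \<open>i'\<close> and \<open>i\<close>.\<close>
  define i' where "i' = (if i = 0 then n - 1 else i - 1)"
  have i': "i' < n" "Suc i' mod n = i" "i' \<noteq> Suc i mod n" "i' \<noteq> i"
    using i assms(1) unfolding i'_def by (auto simp: mod_Suc)
  have "y i' \<noteq> y (Suc i mod n)" "y i' \<noteq> y i"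
    using i i' assms(1) inj_onD[OF assms(2)] by (metis lessThan_iff mod_less_divisor le_less_trans zero_le)+
  then have "{y i, y (Suc i mod n)} \<noteq> {y i', y (Suc i' mod n)}"
    by (auto simp: doubleton_eq_iff)
  then show ?thesis
    using that[OF ring_edgesI[OF i(1)] ring_edgesI[OF i'(1)]] i i' by auto
qed

lemma cycle_nonempty:
  assumes "is_cycle V E C"
  shows "C \<noteq> {}"
proof -
  obtain y n where "n \<ge> 3" "C = ring_edges y n"
    using assms unfolding is_cycle_iff by blast
  then show ?thesis using ring_edgesI[of 0 n y] by auto
qed

lemma cycle_two_edges:
  assumes "is_cycle V E C" "e \<in> C" "x \<in> e"
  obtains e1 e2 where "e1 \<in> C" "e2 \<in> C" "e1 \<noteq> e2" "x \<in> e1" "x \<in> e2"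
  using assms unfolding is_cycle_iff by (metis ring_two_edges)

lemma no_cycle_edge: "\<not> is_cycle V {e} C"
proof
  assume C: "is_cycle V {e} C"
  then have "C = {e}"
    using cycle_nonempty[OF C] unfolding is_cycle_iff by auto
  moreover obtain x where "x \<in> e"
  proof -
    have "e \<in> C" using \<open>C = {e}\<close> by simp
    then show ?thesis using that C unfolding is_cycle_iff ring_edges_def by blast
  qed
  ultimately show False using cycle_two_edges[OF C, of e x] by auto
qed

text \<open>Each vertex lies on only two ring edges, and a cycle uses two edges at each of its
  vertices. So a cycle containing one ring edge contains the next, and thus all of them.\<close>

lemma ring_cycles:
  assumes n: "n \<ge> 3" and inj: "inj_on y {..<n}"
  shows "is_cycle (y ` {..<n}) (ring_edges y n) C \<longleftrightarrow> C = ring_edges y n"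
proof
  assume C: "is_cycle (y ` {..<n}) (ring_edges y n) C"
  then have sub: "C \<subseteq> ring_edges y n" unfolding is_cycle_iff by auto
  then obtain p where p: "p < n" "{y p, y (Suc p mod n)} \<in> C"
    using cycle_nonempty[OF C] unfolding ring_edges_def by auto
  have step: "{y (Suc i mod n), y (Suc (Suc i mod n) mod n)} \<in> C"
    if i: "i < n" "{y i, y (Suc i mod n)} \<in> C" for i
  proof -
    let ?w = "y (Suc i mod n)"
    have cases: "f = {y i, ?w} \<or> f = {?w, y (Suc (Suc i mod n) mod n)}"
      if f: "f \<in> ring_edges y n" "?w \<in> f" for f
    proof -
      obtain j where j: "j < n" "f = {y j, y (Suc j mod n)}"
        using f unfolding ring_edges_def by auto
      have lt: "Suc i mod n < n" "Suc j mod n < n" using n by auto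
      have "?w = y j \<or> ?w = y (Suc j mod n)" using f(2) j by auto
      then have "Suc i mod n = j \<or> Suc i mod n = Suc j mod n"
        using lt j inj_onD[OF inj] by (metis lessThan_iff)
      then show ?thesis using j i Suc_mod_inj by metis
    qed
    obtain e1 e2 where "e1 \<in> C" "e2 \<in> C" "e1 \<noteq> e2" "?w \<in> e1" "?w \<in> e2"
      using cycle_two_edges[OF C i(2)] by blast
    moreover from this have "e1 \<in> ring_edges y n" "e2 \<in> ring_edges y n" using sub by auto
    ultimately show ?thesis using cases[of e1] cases[of e2] by blast
  qed
  have all: "{y ((p + j) mod n), y (Suc ((p + j) mod n) mod n)} \<in> C" for j
  proof (induction j)
    case 0
    then show ?case using p by simp
  next
    case (Suc j)
    then show ?case using step[OF _ Suc] n by (simp add: mod_simps)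
  qed
  have "{y i, y (Suc i mod n)} \<in> C" if "i < n" for i
    using all[of "i + n - p"] p(1) that by simp
  then show "C = ring_edges y n" using sub unfolding ring_edges_def by blast
next
  assume "C = ring_edges y n"
  then show "is_cycle (y ` {..<n}) (ring_edges y n) C"
    unfolding is_cycle_iff using assms by (intro exI[of _ y] exI[of _ n]) simp
qed

lemma is_cycle_mono: "is_cycle V E C \<Longrightarrow> V \<subseteq> V' \<Longrightarrow> E \<subseteq> E' \<Longrightarrow> is_cycle V' E' C"
  unfolding is_cycle_iff by (elim exE conjE, intro exI conjI) (assumption | erule (1) order_trans)+

section \<open>Cycles of a glued graph\<close>

context glue
begin

lemma edge_side:
  assumes "e \<in> E1 \<union> E2" "f \<in> E1 \<union> E2" "w \<in> e" "w \<in> f" "w \<noteq> a"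
  shows "e \<in> E1 \<longleftrightarrow> f \<in> E1"
proof -
  have "w \<in> V1" if "g \<in> E1" "w \<in> g" for g
    using that simple_graph_edgeE[OF sg1] by blast
  moreover have "w \<in> V2" if "g \<in> E2" "w \<in> g" for g
    using that simple_graph_edgeE[OF sg2] by blast
  ultimately show ?thesis using assms inter by blast
qed

text \<open>A cycle visits \<open>a\<close> at most once. Cut open there, its consecutive edges
  share vertices other than \<open>a\<close>, hence all lie on one side.\<close>

lemma cycle_glue:
  "is_cycle (V1 \<union> V2) (E1 \<union> E2) C \<longleftrightarrow> is_cycle V1 E1 C \<or> is_cycle V2 E2 C"
proof
  assume "is_cycle (V1 \<union> V2) (E1 \<union> E2) C"
  then obtain y n where y: "n \<ge> 3" "inj_on y {..<n}" "C = ring_edges y n" "C \<subseteq> E1 \<union> E2"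
    unfolding is_cycle_iff by blast
  define e where "e i = {y i, y (Suc i mod n)}" for i
  have C: "C = e ` {..<n}" unfolding y(3) ring_edges_def e_def by auto
  \<comment> \<open>The position of \<open>a\<close> on the cycle, or 0 if the cycle avoids
    \<open>a\<close>.\<close>
  obtain p where p: "p < n" "\<And>i. i < n \<Longrightarrow> y i = a \<Longrightarrow> i = p"
  proof (cases "\<exists>p<n. y p = a")
    case True
    then show ?thesis using that inj_onD[OF y(2)] by (metis lessThan_iff)
  next
    case False
    then show ?thesis using that[of 0] y(1) by auto
  qed
  have step: "e i \<in> E1 \<longleftrightarrow> e (Suc i mod n) \<in> E1" if "i < n" "Suc i mod n \<noteq> p" for i
  proof (rule edge_side)
    show "e i \<in> E1 \<union> E2" "e (Suc i mod n) \<in> E1 \<union> E2"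
      using y(4) that(1) mod_less_divisor[of n "Suc i"] y(1) unfolding C by blast+
    show "y (Suc i mod n) \<noteq> a" using p(2)[of "Suc i mod n"] that y(1) by auto
  qed (auto simp: e_def)
  \<comment> \<open>Starting from index \<open>p\<close>, fewer than \<open>n\<close> steps never
    cross \<open>y p\<close> again.\<close>
  have all: "e ((p + j) mod n) \<in> E1 \<longleftrightarrow> e p \<in> E1" if "j < n" for j
    using that
  proof (induction j)
    case 0
    then show ?case using p by simp
  next
    case (Suc j)
    have "(p + Suc j) mod n \<noteq> p"
      using Suc.prems p(1) by (cases "p + Suc j < n") (auto simp: le_mod_geq)
    then show ?case
      using step[of "(p + j) mod n"] Suc y(1) by (simp add: mod_simps)
  qed
  have same: "e i \<in> E1 \<longleftrightarrow> e p \<in> E1" if "i < n" for i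
  proof -
    define j where "j = (if p \<le> i then i - p else i + n - p)"
    have "j < n" "(p + j) mod n = i" using that p(1) unfolding j_def by auto
    then show ?thesis using all[of j] by simp
  qed
  have inE: "is_cycle V E C" if sg: "simple_graph V E" and sub: "C \<subseteq> E" for V E
  proof -
    have "y i \<in> V" if "i < n" for i
      using sub that C simple_graphD(1)[OF sg, of "y i" "y (Suc i mod n)"] unfolding e_def by blast
    then show ?thesis using y sub unfolding is_cycle_iff by blast
  qed
  have "C \<subseteq> E1 \<or> C \<subseteq> E2" using same y(4) C by blast
  then show "is_cycle V1 E1 C \<or> is_cycle V2 E2 C" using inE sg1 sg2 by blast
qed (auto elim: is_cycle_mono)

end

section \<open>Distances in paths and cycles\<close>

definition path_edges :: "(nat \<Rightarrow> 'a) \<Rightarrow> nat \<Rightarrow> 'a set set" where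
  "path_edges z m = {{z i, z (Suc i)} | i. Suc i < m}"

text \<open>Truncated subtraction: the summand is the absolute difference of \<open>i\<close> and \<open>s\<close>.\<close>
definition path_trans :: "nat \<Rightarrow> nat \<Rightarrow> nat" where
  "path_trans m s = (\<Sum>i<m. (i - s) + (s - i))"

definition ring_trans :: "nat \<Rightarrow> nat" where
  "ring_trans n = (\<Sum>i<n. min i (n - i))"

lemma path_graph:
  assumes inj: "inj_on z {..<m}"
  shows "cgraph (z ` {..<m}) (path_edges z m)"
    and "s < m \<Longrightarrow> trans_from (z ` {..<m}) (path_edges z m) (z s) = path_trans m s"
proof -
  let ?V = "z ` {..<m}" and ?E = "path_edges z m"
  have sg: "simple_graph ?V ?E"
    unfolding simple_graph_def
  proof (intro conjI ballI)
    fix e assume "e \<in> ?E"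
    then obtain i where i: "Suc i < m" "e = {z i, z (Suc i)}" unfolding path_edges_def by auto
    moreover have "z i \<noteq> z (Suc i)" using i inj_onD[OF inj, of i "Suc i"] by auto
    ultimately show "\<exists>u v. u \<in> ?V \<and> v \<in> ?V \<and> u \<noteq> v \<and> e = {u, v}"
      by (intro exI[of _ "z i"] exI[of _ "z (Suc i)"]) auto
  qed simp
  define ix where "ix = the_inv_into {..<m} z"
  have ix: "ix (z i) = i" if "i < m" for i
    unfolding ix_def using that inj by (simp add: the_inv_into_f_f)
  define d where "d s v = (ix v - s) + (s - ix v)" for s v
  have d0: "d s (z s) = 0" if "s < m" for s using that by (simp add: d_def ix)
  have pred: "\<exists>x. {x, v} \<in> ?E \<and> d s v = Suc (d s x)" if s: "s < m" and v: "v \<in> ?V" "v \<noteq> z s" for s v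
  proof -
    obtain i where i: "i < m" "v = z i" "i \<noteq> s" using v by auto
    show ?thesis
    proof (cases "i < s")
      case True
      then have "{z (Suc i), v} \<in> ?E" "d s v = Suc (d s (z (Suc i)))"
        using i s by (auto simp: path_edges_def d_def ix insert_commute)
      then show ?thesis by blast
    next
      case False
      then obtain j where "i = Suc j" using i(3) not0_implies_Suc[of i] by auto
      then have "{z j, v} \<in> ?E" "d s v = Suc (d s (z j))"
        using i False by (auto simp: path_edges_def d_def ix)
      then show ?thesis by blast
    qed
  qed
  have lip: "d s y \<le> Suc (d s x)" if "{x, y} \<in> ?E" for s x y
    using that by (auto simp: path_edges_def d_def doubleton_eq_iff ix)
  have "(u, v) \<in> (adj ?E)\<^sup>*" if uv: "u \<in> ?V" "v \<in> ?V" for u v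
  proof -
    obtain s where s: "s < m" "u = z s" using uv by auto
    then have "(u, v) \<in> adj ?E ^^ d s v"
      using uv d0 pred[OF s(1)] by (intro potential_reach[OF sg]) auto
    then show ?thesis by (auto simp: rtrancl_power)
  qed
  then show "cgraph ?V ?E" using sg by (simp add: cgraph_def connected_graph_iff)
  assume s: "s < m"
  have "gdist ?V ?E (z s) v = d s v" if "v \<in> ?V" for v
    using s d0 pred lip that by (intro gdist_eqI sg) auto
  then have "trans_from ?V ?E (z s) = (\<Sum>i<m. d s (z i))"
    unfolding trans_from_def by (simp add: sum.reindex[OF inj])
  also have "\<dots> = path_trans m s"
    unfolding path_trans_def by (intro sum.cong) (auto simp: d_def ix)
  finally show "trans_from ?V ?E (z s) = path_trans m s" .
qed

lemma wiener2_path: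
  assumes "inj_on z {..<m}"
  shows "wiener2 (z ` {..<m}) (path_edges z m) = (\<Sum>s<m. path_trans m s)"
  unfolding wiener2_def using path_graph(2)[OF assms] by (simp add: sum.reindex[OF assms])

text \<open>The distance from \<open>y 0\<close> is the length of the shorter arc. Other starting
  vertices follow by rotation.\<close>

lemma ring_graph:
  assumes n: "n \<ge> 3" and inj: "inj_on y {..<n}"
  shows "cgraph (y ` {..<n}) (ring_edges y n)"
    and "trans_from (y ` {..<n}) (ring_edges y n) (y 0) = ring_trans n"
proof -
  let ?V = "y ` {..<n}" and ?E = "ring_edges y n"
  have sg: "simple_graph ?V ?E"
    unfolding simple_graph_def
  proof (intro conjI ballI)
    fix e assume "e \<in> ?E"
    then obtain i where i: "i < n" "e = {y i, y (Suc i mod n)}" unfolding ring_edges_def by auto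
    moreover have "y i \<noteq> y (Suc i mod n)"
      using i n inj_onD[OF inj, of i "Suc i mod n"] by (auto simp: mod_Suc split: if_splits)
    ultimately show "\<exists>u v. u \<in> ?V \<and> v \<in> ?V \<and> u \<noteq> v \<and> e = {u, v}"
      by (intro exI[of _ "y i"] exI[of _ "y (Suc i mod n)"]) auto
  qed simp
  define ix where "ix = the_inv_into {..<n} y"
  have ix: "ix (y i) = i" if "i < n" for i
    unfolding ix_def using that inj by (simp add: the_inv_into_f_f)
  define d where "d v = min (ix v) (n - ix v)" for v
  have y0: "y 0 \<in> ?V" "d (y 0) = 0" using n by (auto simp: d_def ix)
  have pred: "\<exists>x. {x, v} \<in> ?E \<and> d v = Suc (d x)" if v: "v \<in> ?V" "v \<noteq> y 0" for v
  proof -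
    obtain j where j: "Suc j < n" "v = y (Suc j)"
      using v not0_implies_Suc by (metis imageE lessThan_iff)
    show ?thesis
    proof (cases "Suc j \<le> n - Suc j")
      case True
      have "{y j, v} \<in> ?E" using ring_edgesI[of j n y] j by simp
      moreover have "d v = Suc (d (y j))" using True j by (auto simp: d_def ix)
      ultimately show ?thesis by blast
    next
      \<comment> \<open>Here the shorter arc runs upwards, and from the last index it wraps around
        to 0.\<close>
      case False
      have "{y (Suc (Suc j) mod n), v} \<in> ?E"
        using ring_edgesI[of "Suc j" n y] j by (simp add: insert_commute)
      moreover have "d v = Suc (d (y (Suc (Suc j) mod n)))"
        using False j by (auto simp: d_def ix mod_Suc)
      ultimately show ?thesis by blast
    qed
  qed
  have lip: "d w \<le> Suc (d x)" if e: "{x, w} \<in> ?E" for x w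
  proof -
    obtain i where i: "i < n" "{x, w} = {y i, y (Suc i mod n)}"
      using e unfolding ring_edges_def by auto
    have "d (y i) = min i (n - i)"
        "d (y (Suc i mod n)) = (if Suc i = n then 0 else min (Suc i) (n - Suc i))"
      using i(1) by (auto simp: d_def ix mod_Suc)
    then have "d (y i) \<le> Suc (d (y (Suc i mod n)))" "d (y (Suc i mod n)) \<le> Suc (d (y i))"
      using i(1) by auto
    then show ?thesis using i(2) by (auto simp: doubleton_eq_iff)
  qed
  have from0: "(y 0, v) \<in> (adj ?E)\<^sup>*" if "v \<in> ?V" for v
    using potential_reach[OF sg y0 pred that] by (auto simp: rtrancl_power)
  have "(u, v) \<in> (adj ?E)\<^sup>*" if "u \<in> ?V" "v \<in> ?V" for u v
    using from0 that sym_rtrancl[OF sym_adj] by (meson rtrancl_trans symE)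
  then show "cgraph ?V ?E" using sg by (simp add: cgraph_def connected_graph_iff)
  have "gdist ?V ?E (y 0) v = d v" if "v \<in> ?V" for v
    using gdist_eqI[OF sg y0 pred lip that] .
  then have "trans_from ?V ?E (y 0) = (\<Sum>i<n. d (y i))"
    unfolding trans_from_def by (simp add: sum.reindex[OF inj])
  also have "\<dots> = ring_trans n"
    unfolding ring_trans_def by (intro sum.cong) (auto simp: d_def ix)
  finally show "trans_from ?V ?E (y 0) = ring_trans n" .
qed

lemma wiener2_ring:
  assumes n: "n \<ge> 3" and inj: "inj_on y {..<n}"
  shows "wiener2 (y ` {..<n}) (ring_edges y n) = n * ring_trans n"
proof -
  have "trans_from (y ` {..<n}) (ring_edges y n) (y s) = ring_trans n" if "s < n" for s
    using ring_graph(2)[OF n inj_rotate(1)[OF _ inj, of s]] n that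
    by (simp add: inj_rotate(2)[OF _ inj] ring_edges_rotate)
  then show ?thesis unfolding wiener2_def by (simp add: sum.reindex[OF inj])
qed

lemma ring_delete_last:
  assumes n: "n \<ge> 3" and inj: "inj_on y {..<n}"
  shows "y ` {..<n} - {y (n - 1)} = y ` {..<n - 1}"
    "del_vertex_E (ring_edges y n) (y (n - 1)) = path_edges y (n - 1)"
proof -
  have eq: "y i = y (n - 1) \<longleftrightarrow> i = n - 1" if "i < n" for i
    using that inj_onD[OF inj, of i "n - 1"] n by auto
  have "{..<n} = insert (n - 1) {..<n - 1}" using n by auto
  then show "y ` {..<n} - {y (n - 1)} = y ` {..<n - 1}" using eq by auto
  have "\<exists>i. e = {y i, y (Suc i)} \<and> Suc i < n - 1"
    if "e = {y i, y (Suc i mod n)}" "i < n" "y (n - 1) \<notin> e" for e i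
  proof -
    have "i \<noteq> n - 1" "Suc i mod n \<noteq> n - 1" using that by auto
    then have "Suc i < n - 1" "Suc i mod n = Suc i" using that by (auto simp: mod_Suc split: if_splits)
    then show ?thesis using that by metis
  qed
  moreover have "\<exists>i'. {y i, y (Suc i)} = {y i', y (Suc i' mod n)} \<and> i' < n"
    if "Suc i < n - 1" for i
    using that by (intro exI[of _ i]) auto
  moreover have "y (n - 1) \<notin> {y i, y (Suc i)}" if "Suc i < n - 1" for i
  proof -
    have "i < n" "Suc i < n" "i \<noteq> n - 1" "Suc i \<noteq> n - 1" using that by auto
    then show ?thesis using eq[of i] eq[of "Suc i"] by auto
  qed
  ultimately show "del_vertex_E (ring_edges y n) (y (n - 1)) = path_edges y (n - 1)"
    unfolding del_vertex_E_def ring_edges_def path_edges_def by blast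
qed

text \<open>After a rotation the deleted vertex has the last index, and what remains is a path in
  index order.\<close>

lemma ring_delete:
  assumes n: "n \<ge> 3" and inj: "inj_on y {..<n}" and t: "0 < t" "t < n"
  defines "V' \<equiv> y ` {..<n} - {y t}" and "E' \<equiv> del_vertex_E (ring_edges y n) (y t)"
  shows "cgraph V' E'" "wiener2 V' E' = (\<Sum>s<n - 1. path_trans (n - 1) s)"
    "trans_from V' E' (y 0) = path_trans (n - 1) (n - 1 - t)"
proof -
  \<comment> \<open>Numbering starts just after \<open>y t\<close>, so \<open>y t\<close> is
    \<open>z (n - 1)\<close> and \<open>y 0\<close> is \<open>z (n - 1 - t)\<close>.\<close>
  define z where "z i = y ((Suc t + i) mod n)" for i
  have z: "inj_on z {..<n}" "z ` {..<n} = y ` {..<n}" "ring_edges z n = ring_edges y n"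
    unfolding z_def using n inj_rotate[OF _ inj, of "Suc t"] ring_edges_rotate[of n y "Suc t"] by auto
  have inj': "inj_on z {..<n - 1}" by (rule inj_on_subset[OF z(1)]) auto
  have "z (n - 1) = y t" using n t by (simp add: z_def)
  then have V': "V' = z ` {..<n - 1}" and E': "E' = path_edges z (n - 1)"
    unfolding V'_def E'_def using ring_delete_last[OF n z(1)] z by auto
  show "cgraph V' E'" "wiener2 V' E' = (\<Sum>s<n - 1. path_trans (n - 1) s)"
    unfolding V' E' by (rule path_graph(1)[OF inj'] wiener2_path[OF inj'])+
  have "y 0 = z (n - 1 - t)" using t by (simp add: z_def)
  then show "trans_from V' E' (y 0) = path_trans (n - 1) (n - 1 - t)"
    unfolding V' E' using path_graph(2)[OF inj', of "n - 1 - t"] t by simp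
qed

section \<open>Comparing transmissions in paths and cycles\<close>

lemma path_trans_formula:
  "2 * path_trans (Suc (s + r)) s = s * (s + 1) + r * (r + 1)"
proof (induction r)
  case 0
  have "(\<Sum>i<Suc s. (i - s) + (s - i)) = (\<Sum>i<Suc s. s - i)"
    by (intro sum.cong) auto
  also have "\<dots> = (\<Sum>i<Suc s. i)"
    using sum.nat_diff_reindex[of "\<lambda>i. i" "Suc s"] by simp
  finally have "path_trans (Suc (s + 0)) s = (\<Sum>i<Suc s. i)"
    by (simp only: path_trans_def add_0_right)
  moreover have "2 * (\<Sum>i<Suc s. i) = s * (s + 1)"
    by (induction s) auto
  ultimately show ?case by simp
next
  case (Suc r)
  then show ?case by (simp add: path_trans_def)
qed

text \<open>With \<open>s\<close> vertices on one side and \<open>r\<close> on the other, the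
  transmission falls short of that of an end by exactly \<open>s * r\<close>, which vanishes only at
  the ends.\<close>

lemma path_trans_eq_iff:
  assumes "s < m"
  shows "path_trans m s = path_trans m (m - 1) \<longleftrightarrow> s = 0 \<or> s = m - 1"
proof -
  obtain r where m: "m = Suc (s + r)" using assms less_imp_Suc_add by blast
  have "2 * path_trans m (m - 1) = (s + r) * (s + r + 1)"
    using path_trans_formula[of "s + r" 0] m by simp
  then have "2 * path_trans m (m - 1) = 2 * path_trans m s + 2 * (s * r)"
    using path_trans_formula[of s r] m by (simp add: algebra_simps)
  then show ?thesis using m by auto
qed

text \<open>This is where \<open>c \<ge> 7\<close> enters; for \<open>c = 6\<close> the gap is 1.\<close>
lemma path_ring_gap:
  assumes "c \<ge> 7"
  shows "ring_trans c + 2 \<le> path_trans (c - 1) (c - 2)"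
proof -
  obtain d where c: "c = d + 7" using assms by (metis add.commute le_Suc_ex)
  \<comment> \<open>The last three summands of \<open>ring_trans c\<close> are 3, 2 and 1; the
    earlier ones are bounded by their indices.\<close>
  have "(\<Sum>i<d + 4. min i (d + 7 - i)) \<le> (\<Sum>i<d + 4. i)" by (intro sum_mono) auto
  then have "ring_trans c \<le> (\<Sum>i<d + 4. i) + 6"
    unfolding ring_trans_def c by (simp add: eval_nat_numeral)
  moreover have "2 * path_trans (c - 1) (c - 2) = (d + 5) * (d + 6)"
    using path_trans_formula[of "d + 5" 0] by (simp add: c eval_nat_numeral)
  moreover have "2 * (\<Sum>i<d + 4. i) = (d + 3) * (d + 4)"
    by (induction d) (auto simp: eval_nat_numeral)
  ultimately show ?thesis by (simp add: algebra_simps)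
qed

section \<open>Trees\<close>

text \<open>The first alternative covers pendant vertices, the second cut vertices. Unlike failing
  to be good, this persists when a graph is glued on at another vertex.\<close>

definition never_good :: "'a set \<Rightarrow> 'a set set \<Rightarrow> 'a \<Rightarrow> bool" where
  "never_good V E v \<longleftrightarrow> (\<exists>u\<in>V. u \<noteq> v \<and> (\<forall>e\<in>E. v \<in> e \<longrightarrow> e = {u, v})) \<or>
    \<not> cgraph (V - {v}) (del_vertex_E E v)"

lemma cgraph_singleton: "cgraph {a} {}"
  by (auto simp: cgraph_def simple_graph_def connected_graph_iff)

lemma cgraph_edge:
  assumes "u \<noteq> w"
  shows "cgraph {u, w} {{u, w}}" "trans_from {u, w} {{u, w}} u = 1"
proof -
  have sg: "simple_graph {u, w} {{u, w}}"
    using assms by (auto simp: simple_graph_def)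
  have "(u, w) \<in> adj {{u, w}}" "(w, u) \<in> adj {{u, w}}" by (auto simp: insert_commute)
  then show cg: "cgraph {u, w} {{u, w}}"
    unfolding cgraph_def connected_graph_iff[OF sg] using sg by blast
  have "gdist {u, w} {{u, w}} u w \<le> 1"
    by (rule gdist_le[OF cg]) auto
  then have "gdist {u, w} {{u, w}} u w = 1"
    using gdist_eq_0_iff[OF cg, of u w] assms by simp
  then show "trans_from {u, w} {{u, w}} u = 1"
    unfolding trans_from_def using assms cg by simp
qed

text \<open>Deleting a cut vertex makes the index infinite. If \<open>v\<close> is pendant at
  \<open>u\<close>, the graph is the remainder with an edge glued on at \<open>u\<close>, which
  strictly increases the index.\<close>

lemma never_good_not_good:
  assumes cg: "cgraph V E" and v: "v \<in> V" and never: "never_good V E v"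
  shows "\<not> good_vertex V E v"
proof
  assume good: "good_vertex V E v"
  let ?V = "V - {v}" and ?E = "del_vertex_E E v"
  have cg': "cgraph ?V ?E" and eq: "wiener2 V E = wiener2 ?V ?E"
    using good good_vertex_iff[OF cg v] by auto
  then obtain u where u: "u \<in> V" "u \<noteq> v" and pend: "\<And>e. e \<in> E \<Longrightarrow> v \<in> e \<Longrightarrow> e = {u, v}"
    using never unfolding never_good_def by blast
  obtain x where "{x, v} \<in> E" using gdist_pred[OF cg u(1) v u(2)] by metis
  then have "{u, v} \<in> E" using pend[of "{x, v}"] by simp
  then have E: "E = ?E \<union> {{u, v}}" using pend unfolding del_vertex_E_def by blast
  have V: "V = ?V \<union> {u, v}" using u v by auto
  interpret glue ?V ?E "{u, v}" "{{u, v}}" u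
    using cg' cgraph_edge[OF u(2)] u by unfold_locales auto
  have "wiener2 {u, v} {{u, v}} \<ge> 1"
    unfolding wiener2_def using u(2) cgraph_edge(2)[OF u(2)] by simp
  moreover have "wiener2 V E = wiener2 (?V \<union> {u, v}) (?E \<union> {{u, v}})"
    using V E by (rule arg_cong2)
  ultimately show False using eq wiener2_glue by simp
qed

text \<open>No edge of the first side touches \<open>v\<close>, so a pendant vertex stays pendant; a
  cut vertex stays one by the contrapositive of \<open>connected_part\<close>.\<close>

lemma (in glue) never_good_glue:
  assumes "v \<in> V2" "v \<noteq> a" "never_good V2 E2 v"
  shows "never_good (V1 \<union> V2) (E1 \<union> E2) v"
proof -
  have "v \<notin> e" if "e \<in> E1" for e
    using that assms(1,2) inter simple_graph_edgeE[OF sg1] by blast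
  then show ?thesis
    using assms connected_part unfolding never_good_def by blast
qed

text \<open>The labels of non-root vertices exceed \<open>M\<close>, which keeps them off the cycles.
  The one-vertex graph is excluded in the last clause because deleting its vertex leaves the empty
  graph, which counts as connected with Wiener index 0.\<close>
definition rooted_tree :: "nat \<Rightarrow> nat set \<Rightarrow> nat set set \<Rightarrow> bool" where
  "rooted_tree M V E \<longleftrightarrow> cgraph V E \<and> 0 \<in> V \<and> (\<forall>v\<in>V. v = 0 \<or> M < v) \<and>
    (\<forall>C. \<not> is_cycle V E C) \<and> (V \<noteq> {0} \<longrightarrow> (\<forall>v\<in>V. never_good V E v))"

lemma rooted_tree_leaf:
  assumes T: "rooted_tree M V E" and u: "u \<in> V"
  obtains w where "w \<notin> V" "rooted_tree M (V \<union> {u, w}) (E \<union> {{u, w}})"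
    "glue V E {u, w} {{u, w}} u"
proof -
  have cg: "cgraph V E" and V0: "0 \<in> V" using T by (auto simp: rooted_tree_def)
  obtain w where w: "w \<notin> insert 0 (V \<union> {..M})"
    using ex_new_if_finite[of "insert 0 (V \<union> {..M})"] cgraph_finite[OF cg] by auto
  then have uw: "u \<noteq> w" using u by auto
  interpret glue V E "{u, w}" "{{u, w}}" u
    using cg cgraph_edge[OF uw] u w by unfold_locales auto
  interpret sw: glue "{u, w}" "{{u, w}}" V E u by (rule glue_swap)
  have wE: "w \<notin> e" if "e \<in> E" for e
    using that w simple_graph_edgeE[OF sg1] by blast
  have "never_good (V \<union> {u, w}) (E \<union> {{u, w}}) v" if v: "v \<in> V \<union> {u, w}" for v
  proof -
    \<comment> \<open>The new leaf is pendant. Its neighbour \<open>u\<close> becomes a cut vertex,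
      or is itself pendant if it was the only vertex. The others inherit the property.\<close>
    consider "v = w" | "v = u" "V = {u}" | "v = u" "V \<noteq> {u}" | "v \<in> V" "v \<noteq> u" "v \<noteq> w"
      using v by blast
    then show ?thesis
    proof cases
      case 1
      then show ?thesis unfolding never_good_def using wE u uw by blast
    next
      case 2
      then have "E = {}" using simple_graph_edgeE[OF sg1] by blast
      then show ?thesis
        unfolding never_good_def using 2 uw by (auto simp: insert_commute)
    next
      case 3
      moreover have "{u, w} \<noteq> {u}" using uw by auto
      ultimately show ?thesis using cut_vertex unfolding never_good_def by blast
    next
      case 4
      moreover have "V \<noteq> {0}" using 4 u by auto
      ultimately have "never_good V E v" using T by (auto simp: rooted_tree_def)
      then show ?thesis using sw.never_good_glue[of v] 4 by (simp add: Un_commute)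
    qed
  qed
  moreover have "\<not> is_cycle (V \<union> {u, w}) (E \<union> {{u, w}}) C" for C
    using T cycle_glue no_cycle_edge by (auto simp: rooted_tree_def)
  ultimately have "rooted_tree M (V \<union> {u, w}) (E \<union> {{u, w}})"
    using T w u cgraph_glue by (auto simp: rooted_tree_def)
  then show ?thesis using that w glue_axioms by auto
qed

text \<open>\<open>N\<close> counts the vertices besides the root. The depth clause guarantees a
  place to attach leaves at every depth from 1 to \<open>h + 1\<close>.\<close>

definition tree_params :: "nat \<Rightarrow> nat \<Rightarrow> nat \<Rightarrow> nat \<Rightarrow> bool" where
  "tree_params M h N T \<longleftrightarrow> (\<exists>V E. rooted_tree M V E \<and> card V = Suc N \<and>
    trans_from V E 0 = T \<and> (\<forall>i\<le>h. \<exists>u\<in>V. gdist V E 0 u = i))"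

lemma tree_params_0: "tree_params M 0 0 0"
proof -
  have "rooted_tree M {0} {}"
    using cycle_nonempty[of "{0}" "{}"] cgraph_singleton[of 0]
    by (auto simp: rooted_tree_def is_cycle_iff)
  then show ?thesis
    unfolding tree_params_def using gdist_self[OF cgraph_singleton[of "0::nat"]]
    by (intro exI[of _ "{0}"] exI[of _ "{}"]) (auto simp: trans_from_def)
qed

text \<open>The range of \<open>h'\<close> serves two uses: \<open>h' = h\<close> when only leaves
  are added, \<open>h' = Suc h\<close> when the tree is made deeper.\<close>

lemma tree_params_leaf:
  assumes "tree_params M h N T" "i \<le> h" "h' \<le> max h (Suc i)"
  shows "tree_params M h' (Suc N) (T + Suc i)"
proof -
  obtain V E where VE: "rooted_tree M V E" "card V = Suc N" "trans_from V E 0 = T"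
    and depth: "\<And>j. j \<le> h \<Longrightarrow> \<exists>u\<in>V. gdist V E 0 u = j"
    using assms(1) unfolding tree_params_def by blast
  obtain u where u: "u \<in> V" "gdist V E 0 u = i" using depth assms(2) by blast
  obtain w where w: "w \<notin> V" "rooted_tree M (V \<union> {u, w}) (E \<union> {{u, w}})"
    "glue V E {u, w} {{u, w}} u"
    using rooted_tree_leaf[OF VE(1) u(1)] by blast
  interpret glue V E "{u, w}" "{{u, w}}" u by (rule w(3))
  have uw: "u \<noteq> w" and V0: "0 \<in> V" using u w VE by (auto simp: rooted_tree_def)
  have "trans_from (V \<union> {u, w}) (E \<union> {{u, w}}) 0 = T + Suc i"
    using trans_glue1[OF V0] cgraph_edge(2)[OF uw] VE(3) u uw by simp
  moreover have "card (V \<union> {u, w}) = Suc (Suc N)" using card_glue uw VE by simp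
  moreover have "\<exists>x\<in>V \<union> {u, w}. gdist (V \<union> {u, w}) (E \<union> {{u, w}}) 0 x = j" if "j \<le> h'" for j
  proof (cases "j \<le> h")
    case True
    then show ?thesis using depth[of j] gdist_glue11[OF V0] by blast
  next
    case False
    have "gdist {u, w} {{u, w}} u w = 1"
      using cgraph_edge(2)[OF uw] cgraph_edge(1)[OF uw] uw by (simp add: trans_from_def)
    then have "gdist (V \<union> {u, w}) (E \<union> {{u, w}}) 0 w = Suc i"
      using gdist_glue12[OF V0, of w] u by simp
    then show ?thesis using False that assms(2,3) by (intro bexI[of _ w]) auto
  qed
  ultimately show ?thesis using w(2) unfolding tree_params_def by blast
qed

lemma tree_params_leaves:
  assumes "tree_params M h N T" "i \<le> h"
  shows "tree_params M h (N + x) (T + x * Suc i)"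
  using assms(1)
proof (induction x)
  case (Suc x)
  then have "tree_params M h (Suc (N + x)) (T + x * Suc i + Suc i)"
    using assms(2) by (intro tree_params_leaf[of M h]) auto
  then show ?case by (simp add: algebra_simps)
qed simp

lemma tree_params_depth: "\<exists>N T. tree_params M h N T"
proof (induction h)
  case 0
  then show ?case using tree_params_0 by blast
next
  case (Suc h)
  then show ?case using tree_params_leaf[of M h _ _ h "Suc h"] by auto
qed

text \<open>A leaf at depth \<open>F\<close> leaves \<open>T - F N\<close> unchanged, and one at depth \<open>F - 1\<close> or \<open>F + 1\<close>
  changes it by one.\<close>
lemma tree_balance:
  fixes D :: int
  assumes "F \<ge> 2"
  shows "\<exists>N T. N \<ge> q \<and> 0 < N \<and> tree_params M F N T \<and> int T - int F * int N = D"
proof -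
  obtain N0 T0 where P: "tree_params M F N0 T0" using tree_params_depth by blast
  define D0 where "D0 = D - (int T0 - int F * int N0)"
  \<comment> \<open>The positive and negative parts of the defect \<open>D0\<close>: the numbers of
    leaves at depth \<open>F + 1\<close> and \<open>F - 1\<close>.\<close>
  define x y where "x = nat D0" and "y = nat (- D0)"
  obtain f where f: "F = Suc (Suc f)" using assms by (metis add_2_eq_Suc le_Suc_ex)
  \<comment> \<open>The last \<open>Suc q\<close> leaves, at depth \<open>F\<close>, enlarge the
    tree without disturbing the balance.\<close>
  let ?N = "N0 + x + y + Suc q" and ?T = "T0 + x * Suc F + y * Suc f + Suc q * Suc (Suc f)"
  have "tree_params M F ?N ?T"
    using P f by (intro tree_params_leaves) auto
  moreover have "int ?T - int F * int ?N = int T0 - int F * int N0 + int x - int y"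
    unfolding f by (simp add: algebra_simps)
  moreover have "int x - int y = D0" unfolding x_def y_def by auto
  ultimately show ?thesis
    by (intro exI[of _ ?N] exI[of _ ?T]) (auto simp: D0_def)
qed

section \<open>Bouquets of cycles\<close>

text \<open>Index 0 is the common vertex of all cycles; the remaining labels form disjoint blocks of
  length \<open>c - 1\<close>, so with \<open>k\<close> petals they reach only
  \<open>k * (c - 1)\<close>.\<close>

definition petal :: "nat \<Rightarrow> nat \<Rightarrow> nat \<Rightarrow> nat" where
  "petal c j i = (if i = 0 then 0 else j * (c - 1) + i)"

text \<open>Inserting 0 keeps the root when \<open>J\<close> is empty. A set of indices allows a
  single petal to be taken out.\<close>

definition bouquet_V :: "nat \<Rightarrow> nat set \<Rightarrow> nat set" where
  "bouquet_V c J = insert 0 (\<Union>j\<in>J. petal c j ` {..<c})"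

definition bouquet_E :: "nat \<Rightarrow> nat set \<Rightarrow> nat set set" where
  "bouquet_E c J = (\<Union>j\<in>J. ring_edges (petal c j) c)"

lemma petal_0 [simp]: "petal c j 0 = 0"
  by (simp add: petal_def)

lemma petal_eq_iff:
  assumes "i < c" "i' < c" "i > 0"
  shows "petal c j i = petal c j' i' \<longleftrightarrow> j = j' \<and> i = i'"
proof
  assume eq: "petal c j i = petal c j' i'"
  then have "i' > 0" using assms by (auto simp: petal_def intro!: Nat.gr0I)
  obtain m m' where m: "i = Suc m" "i' = Suc m'"
    using assms(3) \<open>i' > 0\<close> gr0_implies_Suc by blast
  then have "m < c - 1" "m' < c - 1" "j * (c - 1) + m = j' * (c - 1) + m'"
    using eq assms by (auto simp: petal_def)
  \<comment> \<open>Division by \<open>c - 1\<close> recovers the block number.\<close>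
  then have "j = j'"
    by (metis add.commute add_cancel_right_right div_less div_mult_self3 less_nat_zero_code)
  then show "j = j' \<and> i = i'" using eq m by (simp add: petal_def)
qed simp

lemma inj_petal: "inj_on (petal c j) {..<c}"
proof (rule inj_onI)
  fix i i' assume i: "i \<in> {..<c}" "i' \<in> {..<c}" "petal c j i = petal c j i'"
  then show "i = i'"
    using petal_eq_iff[of i c i' j j] petal_eq_iff[of i' c i j j] by (cases "i = 0") auto
qed

lemma petal_gt_0: "0 < i \<Longrightarrow> 0 < petal c j i"
  by (simp add: petal_def)

lemma petal_le:
  assumes "j < k" "i < c"
  shows "petal c j i \<le> k * (c - 1)"
proof -
  have "j * (c - 1) + (c - 1) \<le> k * (c - 1)"
    using mult_le_mono1[of "Suc j" k "c - 1"] assms(1) by simp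
  then show ?thesis using assms(2) by (auto simp: petal_def)
qed

lemma bouquet_inter:
  assumes "j \<notin> J" "c > 0"
  shows "bouquet_V c J \<inter> petal c j ` {..<c} = {0}"
proof -
  have "x = 0" if x: "x \<in> bouquet_V c J" "x \<in> petal c j ` {..<c}" for x
  proof (rule ccontr)
    assume "x \<noteq> 0"
    then obtain j' i' where "j' \<in> J" "i' < c" "x = petal c j' i'"
      using x(1) unfolding bouquet_V_def by auto
    moreover obtain i where "i < c" "x = petal c j i"
      using x(2) by auto
    moreover from this have "i > 0" using \<open>x \<noteq> 0\<close> by (auto intro!: Nat.gr0I)
    ultimately show False using petal_eq_iff[of i c i' j j'] assms by auto
  qed
  moreover have "0 \<in> petal c j ` {..<c}" using assms(2) by (intro image_eqI[of _ _ 0]) auto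
  ultimately show ?thesis by (auto simp: bouquet_V_def)
qed

text \<open>Each petal is glued on at 0, so the order minus one, the transmission of 0 and the set
  of cycles all grow additively.\<close>

lemma bouquet:
  assumes c: "c \<ge> 3" and J: "finite J"
  shows "cgraph (bouquet_V c J) (bouquet_E c J) \<and>
    card (bouquet_V c J) = Suc (card J * (c - 1)) \<and>
    trans_from (bouquet_V c J) (bouquet_E c J) 0 = card J * ring_trans c \<and>
    (\<forall>C. is_cycle (bouquet_V c J) (bouquet_E c J) C \<longleftrightarrow> (\<exists>j\<in>J. C = ring_edges (petal c j) c))"
  using J
proof (induction J)
  case empty
  have "\<not> is_cycle {0} {} C" for C :: "nat set set"
    using cycle_nonempty[of "{0}" "{}" C] by (auto simp: is_cycle_iff)
  then show ?case
    using cgraph_singleton[of "0::nat"] by (simp add: bouquet_V_def bouquet_E_def trans_from_def)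
next
  case (insert j J)
  have V: "bouquet_V c (insert j J) = bouquet_V c J \<union> petal c j ` {..<c}"
    and E: "bouquet_E c (insert j J) = bouquet_E c J \<union> ring_edges (petal c j) c"
    by (auto simp: bouquet_V_def bouquet_E_def)
  interpret glue "bouquet_V c J" "bouquet_E c J" "petal c j ` {..<c}" "ring_edges (petal c j) c" 0
    using insert ring_graph(1)[OF c inj_petal] bouquet_inter[of j J c] c
    by unfold_locales auto
  have "trans_from (petal c j ` {..<c}) (ring_edges (petal c j) c) 0 = ring_trans c"
    using ring_graph(2)[OF c inj_petal[of c j]] by simp
  then show ?case
    unfolding V E
    using cgraph_glue card_glue trans_glue cycle_glue ring_cycles[OF c inj_petal[of c j]]
      card_image[OF inj_petal[of c j]] insert
    by auto
qed

section \<open>The construction\<close>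

lemma bouquet_le:
  assumes "J \<subseteq> {..<k}" "x \<in> bouquet_V c J"
  shows "x \<le> k * (c - 1)"
proof (cases "x = 0")
  case False
  then obtain j i where "j \<in> J" "i < c" "x = petal c j i"
    using assms(2) unfolding bouquet_V_def by auto
  then show ?thesis using petal_le[of j k i c] assms(1) by auto
qed simp

lemma rooted_tree_label: "rooted_tree M V E \<Longrightarrow> v \<in> V \<Longrightarrow> v \<le> M \<Longrightarrow> v = 0"
  unfolding rooted_tree_def using leD by blast

lemma glue_bouquet_tree:
  assumes "c \<ge> 3" "J \<subseteq> {..<k}" "rooted_tree (k * (c - 1)) VT ET"
  shows "glue (bouquet_V c J) (bouquet_E c J) VT ET 0"
proof
  show "cgraph (bouquet_V c J) (bouquet_E c J)" "cgraph VT ET"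
    using bouquet[OF assms(1) finite_subset[OF assms(2)]] assms(3) by (simp_all add: rooted_tree_def)
  have "x = 0" if "x \<in> bouquet_V c J" "x \<in> VT" for x
    using rooted_tree_label[OF assms(3) that(2)] bouquet_le[OF assms(2) that(1)] by simp
  moreover have "0 \<in> bouquet_V c J" "0 \<in> VT"
    using assms(3) by (auto simp: bouquet_V_def rooted_tree_def)
  ultimately show "bouquet_V c J \<inter> VT = {0}" by blast
qed

text \<open>Non-root vertices inherit \<open>never_good\<close> from the tree. The root separates
  the tree from the petals, and for \<open>k = 0\<close> the graph is the tree itself.\<close>

lemma tree_vertex_not_good:
  assumes c: "c \<ge> 3" and T: "rooted_tree (k * (c - 1)) VT ET" and VT: "VT \<noteq> {0}" and v: "v \<in> VT"
  shows "\<not> good_vertex (bouquet_V c {..<k} \<union> VT) (bouquet_E c {..<k} \<union> ET) v"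
proof -
  interpret glue "bouquet_V c {..<k}" "bouquet_E c {..<k}" VT ET 0
    by (rule glue_bouquet_tree[OF c subset_refl T])
  have never: "never_good VT ET v" using T VT v by (simp add: rooted_tree_def)
  have "never_good (bouquet_V c {..<k} \<union> VT) (bouquet_E c {..<k} \<union> ET) v"
  proof (cases "v = 0")
    case False
    then show ?thesis using never_good_glue[OF v _ never] by simp
  next
    case v0: True
    show ?thesis
    proof (cases "k = 0")
      case True
      then have "bouquet_V c {..<k} \<union> VT = VT" "bouquet_E c {..<k} \<union> ET = ET"
        using a2 by (auto simp: bouquet_V_def bouquet_E_def)
      then show ?thesis using never by simp
    next
      case False
      then have "petal c 0 1 \<in> bouquet_V c {..<k}"
        using c unfolding bouquet_V_def by (intro insertI2 UN_I[of 0] imageI) auto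
      moreover have "petal c 0 1 \<noteq> 0" using petal_gt_0[of 1 c 0] by simp
      ultimately have "bouquet_V c {..<k} \<noteq> {0}" by (metis singletonD)
      then show ?thesis using cut_vertex VT v0 by (simp add: never_good_def)
    qed
  qed
  then show ?thesis using never_good_not_good[OF cgraph_glue] v by blast
qed

text \<open>This is \<open>good_glue_iff\<close> with petal \<open>j\<close> as the second side and
  all the rest as the first. \<open>balance\<close> is its equation for \<open>t = 1\<close>, so
  another \<open>t\<close> works exactly if it yields the same path transmission.\<close>

lemma cycle_vertex_good_iff:
  assumes c: "c \<ge> 3" and T: "rooted_tree (k * (c - 1)) VT ET" and N: "card VT = Suc N" "N > 0"
    and j: "j < k" and t: "0 < t" "t < c"
    and balance: "c * ring_trans c + 2 * ((k - 1) * (c - 1) + N) * ring_trans c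
        + 2 * ((k - 1) * ring_trans c + trans_from VT ET 0) =
      (\<Sum>s<c - 1. path_trans (c - 1) s)
        + 2 * ((k - 1) * (c - 1) + N) * path_trans (c - 1) (c - 2)"
  shows "good_vertex (bouquet_V c {..<k} \<union> VT) (bouquet_E c {..<k} \<union> ET) (petal c j t) \<longleftrightarrow>
    t = 1 \<or> t = c - 1"
proof -
  let ?J = "{..<k} - {j}" and ?y = "petal c j"
  let ?V1 = "bouquet_V c ?J \<union> VT" and ?E1 = "bouquet_E c ?J \<union> ET"
    and ?V2 = "?y ` {..<c}" and ?E2 = "ring_edges ?y c"
  interpret g: glue "bouquet_V c ?J" "bouquet_E c ?J" VT ET 0
    by (rule glue_bouquet_tree[OF c _ T]) auto
  have "x = 0" if "x \<in> VT" "x \<in> ?V2" for x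
  proof -
    have "x \<le> k * (c - 1)" using that(2) petal_le[OF j] by auto
    then show ?thesis by (rule rooted_tree_label[OF T that(1)])
  qed
  then have "?V1 \<inter> ?V2 = {0}"
    using bouquet_inter[of j ?J c] c g.a2 by auto
  then interpret glue ?V1 ?E1 ?V2 ?E2 0
    using g.cgraph_glue ring_graph(1)[OF c inj_petal] by unfold_locales auto
  have V: "bouquet_V c {..<k} \<union> VT = ?V1 \<union> ?V2" and E: "bouquet_E c {..<k} \<union> ET = ?E1 \<union> ?E2"
    using j by (auto simp: bouquet_V_def bouquet_E_def)
  have b: "card (bouquet_V c ?J) = Suc ((k - 1) * (c - 1))"
      "trans_from (bouquet_V c ?J) (bouquet_E c ?J) 0 = (k - 1) * ring_trans c"
    using bouquet[OF c, of ?J] j by auto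
  have card1: "card ?V1 - 1 = (k - 1) * (c - 1) + N"
    using g.card_glue b N by simp
  have trans1: "trans_from ?V1 ?E1 0 = (k - 1) * ring_trans c + trans_from VT ET 0"
    using g.trans_glue b by simp
  have y0: "?y 0 = 0" by simp
  have pt: "?y t \<in> ?V2" "?y t \<noteq> 0" using t petal_gt_0[of t c j] by auto
  note del = ring_delete[OF c inj_petal t, of j]
  have "good_vertex (?V1 \<union> ?V2) (?E1 \<union> ?E2) (?y t) \<longleftrightarrow>
    c * ring_trans c + 2 * ((k - 1) * (c - 1) + N) * ring_trans c
        + 2 * ((k - 1) * ring_trans c + trans_from VT ET 0) =
      (\<Sum>s<c - 1. path_trans (c - 1) s)
        + 2 * ((k - 1) * (c - 1) + N) * path_trans (c - 1) (c - 1 - t)"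
    using good_glue_iff[OF pt del(1)] del(2,3) wiener2_ring[OF c inj_petal[of c j]]
      ring_graph(2)[OF c inj_petal[of c j]]
    unfolding card1 trans1 y0 by simp
  \<comment> \<open>A positive \<open>N\<close> keeps the coefficient nonzero even for a single
    petal, so it can be cancelled.\<close>
  also have "\<dots> \<longleftrightarrow> path_trans (c - 1) (c - 1 - t) = path_trans (c - 1) (c - 2)"
    unfolding balance using N(2) by auto
  also have "\<dots> \<longleftrightarrow> t = 1 \<or> t = c - 1"
    using path_trans_eq_iff[of "c - 1 - t" "c - 1"] t c by (auto simp: numeral_2_eq_2)
  finally show ?thesis unfolding V E .
qed

text \<open>\<open>A\<close> and \<open>B\<close> stand for the number of non-root vertices and the
  transmission contributed by the other petals. All terms are even, and the halved equation
  prescribes \<open>T - F * N\<close>.\<close>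

lemma exists_balanced_tree:
  assumes c: "c \<ge> 7"
  shows "\<exists>VT ET N. rooted_tree M VT ET \<and> card VT = Suc N \<and> N > 0 \<and> N \<ge> q \<and>
    c * ring_trans c + 2 * (A + N) * ring_trans c + 2 * (B + trans_from VT ET 0) =
      (\<Sum>s<c - 1. path_trans (c - 1) s) + 2 * (A + N) * path_trans (c - 1) (c - 2)"
proof -
  let ?R = "ring_trans c" and ?P = "\<Sum>s<c - 1. path_trans (c - 1) s"
  have c3: "c \<ge> 3" using c by simp
  define F where "F = path_trans (c - 1) (c - 2) - ?R"
  have F: "F \<ge> 2" "path_trans (c - 1) (c - 2) = ?R + F"
    using path_ring_gap[OF c] unfolding F_def by auto
  have "even (c * ?R)"
    using even_wiener2[OF ring_graph(1)[OF c3 inj_petal[of c 0]]] wiener2_ring[OF c3 inj_petal[of c 0]]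
    by simp
  then obtain r where r: "c * ?R = 2 * r" by (auto elim: evenE)
  have "even ?P"
    using even_wiener2 ring_delete(1,2)[OF c3 inj_petal[of c 0], of 1] c by fastforce
  then obtain p where p: "?P = 2 * p" by (auto elim: evenE)
  \<comment> \<open>Solves \<open>r + B + T = p + F * (A + N)\<close> for
    \<open>T - F * N\<close>.\<close>
  define D where "D = int p - int r - int B + int F * int A"
  obtain N T where N: "N \<ge> q" "0 < N" "tree_params M F N T" "int T - int F * int N = D"
    using tree_balance[OF F(1)] by blast
  then obtain VT ET where VT: "rooted_tree M VT ET" "card VT = Suc N" "trans_from VT ET 0 = T"
    unfolding tree_params_def by blast
  have "int (r + B + T) = int (p + F * (A + N))"
    using N(4) unfolding D_def by (simp add: algebra_simps)
  then have "r + B + T = p + F * (A + N)" by (simp only: of_nat_eq_iff)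
  then have "c * ?R + 2 * (A + N) * ?R + 2 * (B + T) =
      ?P + 2 * (A + N) * path_trans (c - 1) (c - 2)"
    unfolding F(2) r p by (simp add: algebra_simps)
  then show ?thesis using VT N by blast
qed

section \<open>Assembling the graphs and counting their cycles and good vertices\<close>

definition admissible :: "nat \<Rightarrow> nat \<Rightarrow> nat set \<times> nat set set \<Rightarrow> bool" where
  "admissible k c G \<longleftrightarrow> cactus (fst G) (snd G) \<and>
     card {C. is_cycle (fst G) (snd G) C \<and> card C = c} = k \<and>
     card {v \<in> fst G. good_vertex (fst G) (snd G) v} = 2 * k"

lemma exists_large_admissible:
  assumes c: "c \<ge> 7"
  shows "\<exists>G. admissible k c G \<and> card (fst G) \<ge> q"
proof -
  have c3: "c \<ge> 3" using c by simp
  obtain VT ET N where T: "rooted_tree (k * (c - 1)) VT ET" "card VT = Suc N" "N > 0" "N \<ge> q"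
    and balance: "c * ring_trans c + 2 * ((k - 1) * (c - 1) + N) * ring_trans c
        + 2 * ((k - 1) * ring_trans c + trans_from VT ET 0) =
      (\<Sum>s<c - 1. path_trans (c - 1) s)
        + 2 * ((k - 1) * (c - 1) + N) * path_trans (c - 1) (c - 2)"
    using exists_balanced_tree[OF c] by metis
  let ?V = "bouquet_V c {..<k} \<union> VT" and ?E = "bouquet_E c {..<k} \<union> ET"
  let ?C = "\<lambda>j. ring_edges (petal c j) c"
  interpret glue "bouquet_V c {..<k}" "bouquet_E c {..<k}" VT ET 0
    by (rule glue_bouquet_tree[OF c3 subset_refl T(1)])
  have cyc: "is_cycle ?V ?E C \<longleftrightarrow> (\<exists>j<k. C = ?C j)" for C
    using cycle_glue bouquet[OF c3, of "{..<k}"] T(1) by (auto simp: rooted_tree_def)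
  have disj: "j = j'" if e: "e \<in> ?C j" "e \<in> ?C j'" for e j j'
  proof -
    obtain i where i: "i < c" "e = {petal c j i, petal c j (Suc i mod c)}"
      using e(1) unfolding ring_edges_def by blast
    obtain i' where i': "i' < c" "e = {petal c j' i', petal c j' (Suc i' mod c)}"
      using e(2) unfolding ring_edges_def by blast
    \<comment> \<open>Every petal edge has an end other than the root, and that end determines the
      petal.\<close>
    obtain l where l: "0 < l" "l < c" "petal c j l \<in> e"
      using that[of "if i = 0 then 1 else i"] i c by (cases "i = 0") auto
    moreover have "i' < c" "Suc i' mod c < c" using i' c by auto
    ultimately obtain l' where "l' < c" "petal c j l = petal c j' l'"
      using i'(2) by blast
    then show ?thesis using petal_eq_iff l by blast
  qed
  have "?C j \<noteq> {}" for j using ring_edgesI[of 0 c] c by fastforce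
  then have "inj_on ?C {..<k}" using disj by (intro inj_onI) blast
  moreover have "{C. is_cycle ?V ?E C \<and> card C = c} = ?C ` {..<k}"
    using cyc card_ring_edges[OF c3 inj_petal] by auto
  ultimately have cycles: "card {C. is_cycle ?V ?E C \<and> card C = c} = k"
    by (simp add: card_image)
  have "C1 = C2" if "is_cycle ?V ?E C1" "is_cycle ?V ?E C2" "e \<in> C1" "e \<in> C2" for e C1 C2
    using that disj cyc by metis
  then have cactus: "cactus ?V ?E"
    using cgraph_glue unfolding cactus_def cgraph_def by metis
  have VT: "VT \<noteq> {0}" using T by auto
  let ?good = "{v \<in> ?V. good_vertex ?V ?E v}"
  \<comment> \<open>The good vertices are the two neighbours of the root on each petal.\<close>
  have "?good = case_prod (petal c) ` ({..<k} \<times> {1, c - 1})"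
  proof (intro equalityI subsetI)
    fix v assume v: "v \<in> ?good"
    then have "v \<notin> VT" using tree_vertex_not_good[OF c3 T(1) VT] by blast
    then obtain j i where ji: "j < k" "i < c" "v = petal c j i"
      using v a2 unfolding bouquet_V_def by auto
    have "i > 0" using ji \<open>v \<notin> VT\<close> a2 by (auto intro!: Nat.gr0I)
    then have "i = 1 \<or> i = c - 1"
      using cycle_vertex_good_iff[OF c3 T(1-3) ji(1) _ ji(2) balance] v ji by simp
    then show "v \<in> case_prod (petal c) ` ({..<k} \<times> {1, c - 1})" using ji by force
  next
    fix v assume "v \<in> case_prod (petal c) ` ({..<k} \<times> {1, c - 1})"
    then obtain j i where ji: "j < k" "i = 1 \<or> i = c - 1" "v = petal c j i" by auto
    then have i: "0 < i" "i < c" using c by auto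
    then have "v \<in> ?V" using ji by (auto simp: bouquet_V_def)
    then show "v \<in> ?good"
      using cycle_vertex_good_iff[OF c3 T(1-3) ji(1) i balance] ji by simp
  qed
  moreover have "inj_on (case_prod (petal c)) ({..<k} \<times> {1, c - 1})"
    using petal_eq_iff c by (intro inj_onI) auto
  ultimately have "card ?good = card ({..<k} \<times> {1, c - 1})"
    by (simp only: card_image)
  then have "card ?good = 2 * k" using c by (simp add: card_cartesian_product)
  then have "admissible k c (?V, ?E)" using cactus cycles by (simp add: admissible_def)
  moreover have "card ?V \<ge> q" using card_glue T by simp
  ultimately show ?thesis by (metis fst_conv)
qed

theorem theorem2:
  fixes k c :: nat
  assumes "c \<ge> 7"
  shows "\<exists>S :: (nat set \<times> nat set set) set. infinite S \<and>
    (\<forall>G\<in>S. cactus (fst G) (snd G) \<and>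
       card {C. is_cycle (fst G) (snd G) C \<and> card C = c} = k \<and>
       card {v \<in> fst G. good_vertex (fst G) (snd G) v} = 2 * k) \<and>
    (\<forall>G\<in>S. \<forall>H\<in>S. G \<noteq> H \<longrightarrow> \<not> graph_iso G H)"
proof -
  \<comment> \<open>The orders of admissible graphs are unbounded. One graph is chosen for each
    order, and isomorphic graphs have equal order.\<close>
  define A where "A = {card (fst G) | G. admissible k c G}"
  have "infinite A"
    unfolding infinite_nat_iff_unbounded_le A_def
    using exists_large_admissible[OF assms] by blast
  define g where "g m = (SOME G. admissible k c G \<and> card (fst G) = m)" for m
  have g: "admissible k c (g m)" "card (fst (g m)) = m" if "m \<in> A" for m
  proof -
    have "\<exists>G. admissible k c G \<and> card (fst G) = m" using that unfolding A_def by blast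
    from someI_ex[OF this] show "admissible k c (g m)" "card (fst (g m)) = m"
      unfolding g_def by auto
  qed
  have "inj_on g A" by (rule inj_on_inverseI[of _ "card \<circ> fst"]) (simp add: g)
  then have "infinite (g ` A)" using \<open>infinite A\<close> finite_imageD by blast
  moreover have "\<not> graph_iso G H" if "G \<in> g ` A" "H \<in> g ` A" "G \<noteq> H" for G H
    using that g(2) bij_betw_same_card unfolding graph_iso_def by fastforce
  ultimately show ?thesis
    using g(1) unfolding admissible_def by (intro exI[of _ "g ` A"]) auto
qed

end
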